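(* Let $E$ be a nonzero real Banach space, let $f, g : E \times E^* \to\, ]-\infty,\infty]$ be proper, convex and lower semicontinuous, with $f \ge q_L$ and $g \ge q_L$ on $E \times E^*$. Suppose that $$\bigcup_{\lambda > 0}\lambda\big[\pi_2\,\mathrm{dom}\,f - \pi_2\,\mathrm{dom}\,g\big] \text{ is a closed subspace of } E^*,$$ and that $\mathrm{coinc}[f]$ and $\mathrm{coinc}[g]$ are quasidense in $E \times E^*$. Then $(f \oplus_1 g)^@ \ge q_L$ on $E \times E^*$, the set $\mathrm{coinc}[(f \oplus_1 g)^@]$ is closed and quasidense in $E \times E^*$, and, for all $(y,y^* ) \in E \times E^*$: $(y,y^* ) \in \mathrm{coinc}[(f \oplus_1 g)^@]$ if and only if there exist $u^{**}, v^{**} \in E^{**}$ such that $(y^*,u^{**}) \in \mathrm{dcoinc}[f^*]$, $(y^*,v^{**}) \in \mathrm{dcoinc}[g^*]$ and $u^{**} + v^{**} = \widehat{y}$.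
   Context: $q_L(x,x^* ) := \langle x, x^*\rangle$ on $E \times E^*$, and $\mathrm{coinc}[k] := \{b \in E \times E^* : k(b) = q_L(b)\}$ for a function $k \ge q_L$ on $E \times E^*$. $\mathrm{dom}\,k$ is the set where $k$ is finite; $k$ is proper if $\mathrm{dom}\,k \neq \emptyset$. $\pi_2(x,x^* ) := x^*$. The partial episum is $(f \oplus_1 g)(x,x^* ) := \inf_{\xi \in E}[f(x - \xi, x^* ) + g(\xi,x^* )]$. The dual of $E \times E^*$ is identified with $E^* \times E^{**}$ under the pairing $\langle (x,x^* ), (y^*,y^{**})\rangle := \langle x, y^*\rangle + \langle x^*, y^{**}\rangle$, and the Fenchel conjugate of a proper convex $k$ on $E\times E^*$ is $k^*(y^*,y^{**}) := \sup_{(x,x^* ) \in E \times E^*}[\langle x, y^*\rangle + \langle x^*, y^{**}\rangle - k(x,x^* )]$. $\widehat{y}$ is the canonical image of $y \in E$ in $E^{**}$, and $k^@(x,x^* ) := k^*(x^*,\widehat{x})$ for $(x,x^* ) \in E \times E^*$. For a function $m$ on $E^* \times E^{**}$ with $m(y^*,y^{**}) \ge \langle y^*, y^{**}\rangle$ everywhere, $\mathrm{dcoinc}[m] := \{(y^*,y^{**}) \in E^* \times E^{**} : m(y^*,y^{**}) = \langle y^*, y^{**}\rangle\}$ (under the stated hypotheses, $f^*$ and $g^*$ satisfy this inequality). $E \times E^*$ is normed by $\|(x,x^* )\| := \sqrt{\|x\|^2 + \|x^*\|^2}$. A subset $A \subset E \times E^*$ is quasidense (in $E \times E^*$) if, for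 all $(x,x^* ) \in E \times E^*$, $\inf_{(s,s^* ) \in A}\big[\frac12\|s-x\|^2 + \frac12\|s^*-x^*\|^2 + \langle s-x, s^*-x^*\rangle\big] \le 0$. *)

theory Defs
  imports "HOL-Analysis.Analysis"
begin

type_synonym 'a dual = "'a \<Rightarrow>\<^sub>L real"

lift_definition canon :: "'a::real_normed_vector \<Rightarrow> 'a dual dual" is
  "\<lambda>x (\<phi> :: 'a dual). blinfun_apply \<phi> x"
  by (rule bounded_bilinear.bounded_linear_left[OF bounded_bilinear_blinfun_apply])

lemma canon_apply [simp]: "blinfun_apply (canon x) \<phi> = blinfun_apply \<phi> x"
  by transfer simp

definition qL :: "'a::real_normed_vector \<times> 'a dual \<Rightarrow> real" where
  "qL b = blinfun_apply (snd b) (fst b)"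

definition eff_dom :: "('b \<Rightarrow> ereal) \<Rightarrow> 'b set" where
  "eff_dom k = {b. \<bar>k b\<bar> \<noteq> \<infinity>}"

text \<open>The first conjunct says that the function takes values in \<open>]-\<infinity>, \<infinity>]\<close>.\<close>

definition proper :: "('b \<Rightarrow> ereal) \<Rightarrow> bool" where
  "proper k \<longleftrightarrow> (\<forall>b. k b \<noteq> -\<infinity>) \<and> eff_dom k \<noteq> {}"

text \<open>Intended for functions that omit \<open>-\<infinity>\<close>; recall that \<open>0 * \<infinity> = 0\<close> in \<^typ>\<open>ereal\<close>.\<close>

definition econvex :: "('b::real_vector \<Rightarrow> ereal) \<Rightarrow> bool" where
  "econvex k \<longleftrightarrow> (\<forall>b c. \<forall>u\<ge>0. \<forall>v\<ge>0. u + v = 1 \<longrightarrow>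
     k (u *\<^sub>R b + v *\<^sub>R c) \<le> ereal u * k b + ereal v * k c)"

definition lsc :: "('b::topological_space \<Rightarrow> ereal) \<Rightarrow> bool" where
  "lsc k \<longleftrightarrow> (\<forall>b. \<forall>r < k b. \<forall>\<^sub>F c in nhds b. r < k c)"

definition coinc :: "('a::real_normed_vector \<times> 'a dual \<Rightarrow> ereal) \<Rightarrow> ('a \<times> 'a dual) set" where
  "coinc k = {b. k b = ereal (qL b)}"

definition dcoinc ::
  "('a::real_normed_vector dual \<times> 'a dual dual \<Rightarrow> ereal) \<Rightarrow> ('a dual \<times> 'a dual dual) set" where
  "dcoinc m = {(y', y''). m (y', y'') = ereal (blinfun_apply y'' y')}"

definition episum1 ::
  "('a::real_normed_vector \<times> 'a dual \<Rightarrow> ereal) \<Rightarrow> ('a \<times> 'a dual \<Rightarrow> ereal) \<Rightarrow> 'a \<times> 'a dual \<Rightarrow> ereal"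
  where "episum1 f g = (\<lambda>(x, x'). INF \<xi>. f (x - \<xi>, x') + g (\<xi>, x'))"

definition conjugate ::
  "('a::real_normed_vector \<times> 'a dual \<Rightarrow> ereal) \<Rightarrow> 'a dual \<times> 'a dual dual \<Rightarrow> ereal" where
  "conjugate k = (\<lambda>(y', y''). SUP (x, x').
     ereal (blinfun_apply y' x + blinfun_apply y'' x') - k (x, x'))"

definition at_conj ::
  "('a::real_normed_vector \<times> 'a dual \<Rightarrow> ereal) \<Rightarrow> 'a \<times> 'a dual \<Rightarrow> ereal" where
  "at_conj k = (\<lambda>(x, x'). conjugate k (x', canon x))"

text \<open>The infimum is taken in \<^typ>\<open>ereal\<close>, so that the empty set is not quasidense.\<close>

definition quasidense :: "('a::real_normed_vector \<times> 'a dual) set \<Rightarrow> bool" where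
  "quasidense A \<longleftrightarrow> (\<forall>x x'. (INF (s, s')\<in>A.
     ereal (1/2 * (norm (s - x))\<^sup>2 + 1/2 * (norm (s' - x'))\<^sup>2 + blinfun_apply (s' - x') (s - x))) \<le> 0)"

end

theory Submission
  imports Defs
begin

text \<open>
  Write \<open>h\<close> for \<^term>\<open>episum1 f g\<close>, \<open>q\<^sub>L\<close> for \<^const>\<open>qL\<close>, and call \<open>(y', y'') \<mapsto> \<langle>y', y''\<rangle>\<close> the pairing
  on the dual of \<open>E \<times> E'\<close>. The idea is to trade quasidensity, which is hard to follow through the
  operation \<open>episum1\<close>, for the inequality "\<open>k\<^sup>* \<ge>\<close> pairing": quasidensity of \<open>coinc k\<close> implies it,
  it passes from \<open>f\<close> and \<open>g\<close> to \<open>h\<close>, and for a convex \<open>k \<ge> q\<^sub>L\<close> it implies quasidensity of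
  \<open>coinc (k\<^sup>@)\<close>.

  \<^item> If \<^term>\<open>coinc f\<close> is quasidense then \<open>f\<^sup>* \<ge>\<close> pairing (\<open>conjugate_ge_of_quasidense_coinc\<close>). Points
    of \<open>coinc f\<close> give affine minorants whose supremum is below \<open>f\<^sup>*\<close>; quasidensity lets them reach
    every \<open>(y', y'')\<close>, because \<open>E \<times> E'\<close> is itself quasidense, in the corresponding sense, in its
    dual.

  \<^item> The constraint on the domains gives an exact formula: \<open>h\<^sup>*(y', y'')\<close> is the minimum of
    \<open>f\<^sup>*(y', u'') + g\<^sup>*(y', v'')\<close> over \<open>u'' + v'' = y''\<close> (\<open>conjugate_episum1_le\<close>,
    \<open>conjugate_episum1_split\<close>). The variables \<open>x'\<close> of \<open>f\<close> and \<open>g\<close>, equal in the definition of \<open>h\<close>,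
    are decoupled; the multiplier for this equality constraint is the required splitting. The
    multiplier exists as soon as the value function of the decoupled problem is bounded above near
    \<open>0\<close> (\<open>convex_duality\<close>, from the Hahn-Banach theorem), and this is a category argument in the
    closed subspace of the hypothesis (\<open>convex_open_mapping\<close>).

  \<^item> Consequently \<open>h\<^sup>* \<ge>\<close> pairing, since the pairing is additive in its second variable; and
    \<open>h\<^sup>*(y', canon y)\<close> equals the pairing iff both summands of an optimal splitting do. This is
    the description of the coincidence set of \<open>h\<^sup>@\<close>. It is closed because \<open>h\<^sup>@\<close> is a supremum of
    continuous functions.

  \<^item> If a convex \<open>k \<ge> q\<^sub>L\<close> satisfies \<open>k\<^sup>* \<ge>\<close> pairing, then the coincidence set of \<open>k\<^sup>@\<close> is
    quasidense (\<open>quasidense_coinc_at_conj\<close>). By duality again, every point \<open>c\<close> admits approximate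
    coincidence points \<open>b\<close> of \<open>k\<close> with \<open>r\<^sub>L (b - c)\<close> small, where
    \<open>r\<^sub>L b = \<parallel>b\<parallel>\<^sup>2 / 2 + q\<^sub>L b \<ge> 0\<close>. Iterating this with decreasing tolerances gives a
    Cauchy sequence, since convexity of \<open>k\<close> bounds \<open>- q\<^sub>L\<close> on differences of approximate
    coincidence points. The limit \<open>b\<close> need not be a coincidence point of \<open>k\<close>, which need not be
    lower semicontinuous, but it is one of \<open>k\<^sup>@\<close>.

  Extended real values are avoided by working with strict epigraphs, which are convex subsets of a
  real vector space. The strict epigraph of \<open>h\<close> is obtained from those of \<open>f\<close> and \<open>g\<close> by addition
  over equal \<open>x'\<close>, so that no infimum has to be attained.
\<close>

section \<open>Sublinear functionals and the Hahn-Banach theorem\<close>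

definition sublinear :: "('a::real_vector \<Rightarrow> real) \<Rightarrow> bool" where
  "sublinear p \<longleftrightarrow>
    (\<forall>x y. p (x + y) \<le> p x + p y) \<and> (\<forall>c>0. \<forall>x. p (c *\<^sub>R x) = c * p x)"

lemma sublinear_add: "sublinear p \<Longrightarrow> p (x + y) \<le> p x + p y"
  and sublinear_scale: "sublinear p \<Longrightarrow> 0 < c \<Longrightarrow> p (c *\<^sub>R x) = c * p x"
  by (auto simp: sublinear_def)

lemma sublinear_zero: "sublinear p \<Longrightarrow> p 0 = 0"
  using sublinear_scale[of p 2 0] by simp

lemma sublinear_minus: "sublinear p \<Longrightarrow> - p (- x) \<le> p x"
  using sublinear_add[of p x "- x"] by (simp add: sublinear_zero)

text \<open>
  The largest sublinear functional satisfying the two bounds: \<open>q z\<close> is the infimum of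
  \<open>p (z + c *\<^sub>R T x) + c * k x\<close> over \<open>c > 0\<close> and \<open>x \<in> D\<close>. Any linear functional below
  \<open>q\<close> inherits \<open>0 \<le> l (T x) + k x\<close> by taking \<open>z = - T x\<close>. The nonnegativity assumption is
  exactly what keeps the infimum finite.
\<close>

lemma sublinear_perturbation:
  fixes p :: "'z::real_vector \<Rightarrow> real" and T :: "'x::real_vector \<Rightarrow> 'z"
  assumes p: "sublinear p" and k: "convex_on D k" and "D \<noteq> {}" and T: "linear T"
    and nonneg: "\<And>x. x \<in> D \<Longrightarrow> 0 \<le> p (T x) + k x"
  obtains q where "sublinear q" "q \<le> p" "\<And>x z. x \<in> D \<Longrightarrow> q z \<le> p (z + T x) + k x"
proof -
  interpret T: linear T by fact
  define V where "V z = (\<lambda>(c, x). p (z + c *\<^sub>R T x) + c * k x) ` ({0<..} \<times> D)" for z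
  define q where "q z = Inf (V z)" for z
  obtain x0 where x0: "x0 \<in> D" using \<open>D \<noteq> {}\<close> by blast
  have VI: "p (z + c *\<^sub>R T x) + c * k x \<in> V z" if "0 < c" "x \<in> D" for z c x
    using that by (force simp: V_def)
  have VE: "\<exists>c x. 0 < c \<and> x \<in> D \<and> v = p (z + c *\<^sub>R T x) + c * k x" if "v \<in> V z" for z v
    using that by (force simp: V_def)
  have lower: "- p (- z) \<le> v" if "v \<in> V z" for z v
  proof -
    obtain c x where cx: "0 < c" "x \<in> D" "v = p (z + c *\<^sub>R T x) + c * k x"
      using VE[OF \<open>v \<in> V z\<close>] by blast
    have "c * p (T x) = p ((z + c *\<^sub>R T x) + - z)"
      using sublinear_scale[OF p \<open>0 < c\<close>, of "T x"] by simp
    also have "\<dots> \<le> p (z + c *\<^sub>R T x) + p (- z)" by (rule sublinear_add[OF p])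
    finally have "c * (p (T x) + k x) \<le> v + p (- z)" using cx by (simp add: algebra_simps)
    moreover have "0 \<le> c * (p (T x) + k x)" using cx nonneg by simp
    ultimately show ?thesis by linarith
  qed
  have bdd: "bdd_below (V z)" for z using lower by (auto intro!: bdd_belowI)
  have ne: "V z \<noteq> {}" for z using VI[of 1 x0] x0 by fastforce
  have le: "q z \<le> v" if "v \<in> V z" for z v unfolding q_def using bdd that by (simp add: cInf_lower)
  have ge: "b \<le> q z" if "\<And>v. v \<in> V z \<Longrightarrow> b \<le> v" for b z
    unfolding q_def using ne that by (rule cInf_greatest)
  have add: "q (y + z) \<le> q y + q z" for y z
  proof -
    have "q (y + z) \<le> v + w" if "v \<in> V y" "w \<in> V z" for v w
    proof -
      obtain c x where cx: "0 < c" "x \<in> D" "v = p (y + c *\<^sub>R T x) + c * k x"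
        using VE[OF \<open>v \<in> V y\<close>] by blast
      obtain d u where du: "0 < d" "u \<in> D" "w = p (z + d *\<^sub>R T u) + d * k u"
        using VE[OF \<open>w \<in> V z\<close>] by blast
      define t where "t = (c / (c + d)) *\<^sub>R x + (d / (c + d)) *\<^sub>R u"
      have cd: "0 \<le> c / (c + d)" "0 \<le> d / (c + d)" "c / (c + d) + d / (c + d) = 1"
        using cx du by (auto simp flip: add_divide_distrib)
      have "convex D" using k by (simp add: convex_on_def)
      then have tD: "t \<in> D" unfolding t_def using cd cx du by (auto simp: convex_def)
      have "k t \<le> c / (c + d) * k x + d / (c + d) * k u"
        unfolding t_def using k cd cx du unfolding convex_on_def by blast
      then have "(c + d) * k t \<le> (c + d) * (c / (c + d) * k x + d / (c + d) * k u)"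
        using cx du by (intro mult_left_mono) auto
      also have "\<dots> = c * k x + d * k u" using cx du by (simp add: distrib_left)
      finally have kt: "(c + d) * k t \<le> c * k x + d * k u" .
      have "(c + d) *\<^sub>R t = c *\<^sub>R x + d *\<^sub>R u" using cx du by (simp add: t_def scaleR_right_distrib)
      then have Tt: "(c + d) *\<^sub>R T t = c *\<^sub>R T x + d *\<^sub>R T u"
        by (metis T.add T.scaleR)
      have "q (y + z) \<le> p (y + z + (c + d) *\<^sub>R T t) + (c + d) * k t"
        using cx du tD by (intro le VI) auto
      also have "y + z + (c + d) *\<^sub>R T t = (y + c *\<^sub>R T x) + (z + d *\<^sub>R T u)"
        by (simp add: Tt)
      also have "p \<dots> \<le> p (y + c *\<^sub>R T x) + p (z + d *\<^sub>R T u)" by (rule sublinear_add[OF p])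
      finally show ?thesis using kt cx du by simp
    qed
    then have "q (y + z) - w \<le> q y" if "w \<in> V z" for w
      using that by (intro ge) (simp add: algebra_simps)
    then have "q (y + z) - q y \<le> q z" by (intro ge) (simp add: algebra_simps)
    then show ?thesis by simp
  qed
  have scale_le: "q (c *\<^sub>R z) \<le> c * q z" if "0 < c" for c z
  proof -
    have "q (c *\<^sub>R z) / c \<le> v" if "v \<in> V z" for v
    proof -
      obtain d x where dx: "0 < d" "x \<in> D" "v = p (z + d *\<^sub>R T x) + d * k x"
        using VE[OF \<open>v \<in> V z\<close>] by blast
      have "q (c *\<^sub>R z) \<le> p (c *\<^sub>R z + (c * d) *\<^sub>R T x) + (c * d) * k x"
        using dx \<open>0 < c\<close> by (intro le VI) auto
      also have "c *\<^sub>R z + (c * d) *\<^sub>R T x = c *\<^sub>R (z + d *\<^sub>R T x)"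
        by (simp add: scaleR_right_distrib)
      finally show ?thesis
        using dx \<open>0 < c\<close> sublinear_scale[OF p \<open>0 < c\<close>, of "z + d *\<^sub>R T x"]
        by (simp add: field_simps)
    qed
    then have "q (c *\<^sub>R z) / c \<le> q z" by (rule ge)
    then show ?thesis using that by (simp add: field_simps)
  qed
  have scale: "q (c *\<^sub>R z) = c * q z" if "0 < c" for c z
    using scale_le[OF that, of z] scale_le[of "inverse c" "c *\<^sub>R z"] that by (simp add: field_simps)
  show ?thesis
  proof
    show "sublinear q" using add scale by (auto simp: sublinear_def)
    show "q z \<le> p (z + T x) + k x" if "x \<in> D" for x z
      using le[OF VI[of 1 x z]] that by simp
    show "q \<le> p"
    proof (rule le_funI)
      fix z
      have "q z \<le> p z + e" if "0 < e" for e
      proof -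
        define a where "a = p (T x0) + k x0"
        have a: "0 \<le> a" using nonneg x0 by (simp add: a_def)
        define c where "c = e / (a + 1)"
        have c: "0 < c" "c * a \<le> e" using a that by (auto simp: c_def field_simps)
        have "q z \<le> p (z + c *\<^sub>R T x0) + c * k x0" using c x0 by (intro le VI) auto
        also have "\<dots> \<le> p z + c * p (T x0) + c * k x0"
          using sublinear_add[OF p, of z "c *\<^sub>R T x0"] sublinear_scale[OF p c(1), of "T x0"] by simp
        also have "\<dots> \<le> p z + e" using c by (simp add: a_def algebra_simps)
        finally show ?thesis .
      qed
      then show "q z \<le> p z" by (rule field_le_epsilon)
    qed
  qed
qed

text \<open>
  Zorn's lemma applies because every sublinear \<open>a \<le> p\<close> satisfies
  \<open>a z \<ge> - a (- z) \<ge> - p (- z)\<close>, so the pointwise infimum of a chain is finite, and it is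
  again sublinear.
\<close>

lemma minimal_sublinear_exists:
  fixes p :: "'z::real_vector \<Rightarrow> real"
  assumes "sublinear p"
  obtains m where "sublinear m" "m \<le> p" "\<And>q. sublinear q \<Longrightarrow> q \<le> m \<Longrightarrow> q = m"
proof -
  define A where "A = {q. sublinear q \<and> q \<le> p}"
  have "\<exists>m\<in>A. \<forall>q\<in>A. q \<le> m \<longrightarrow> q = m"
  proof (rule predicate_Zorn)
    show "partial_order_on A (relation_of (\<lambda>a b. b \<le> a) A)"
      by (intro partial_order_on_relation_ofI) auto
    fix C assume C: "C \<in> Chains (relation_of (\<lambda>a b. b \<le> a) A)"
    have CA: "C \<subseteq> A" and total: "\<And>a b. a \<in> C \<Longrightarrow> b \<in> C \<Longrightarrow> a \<le> b \<or> b \<le> a"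
      using C by (auto simp: Chains_def relation_of_def)
    show "\<exists>u\<in>A. \<forall>a\<in>C. u \<le> a"
    proof (cases "C = {}")
      case True then show ?thesis using assms by (auto simp: A_def)
    next
      case False
      define u where "u z = (INF a\<in>C. a z)" for z
      have sub: "sublinear a" and ap: "a z \<le> p z" if "a \<in> C" for a z
        using that CA by (auto simp: A_def le_fun_def)
      have "- p (- z) \<le> a z" if "a \<in> C" for a z
        using sublinear_minus[OF sub[OF that], of z] ap[OF that, of "- z"] by linarith
      then have bdd: "bdd_below ((\<lambda>a. a z) ` C)" for z by (auto intro!: bdd_belowI)
      have le: "u z \<le> a z" if "a \<in> C" for a z
        unfolding u_def using bdd that by (rule cINF_lower)
      have ge: "b \<le> u z" if "\<And>a. a \<in> C \<Longrightarrow> b \<le> a z" for b z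
        unfolding u_def using False that by (rule cINF_greatest)
      have add: "u (y + z) \<le> u y + u z" for y z
      proof -
        have "u (y + z) \<le> a y + b z" if "a \<in> C" "b \<in> C" for a b
        proof -
          have "\<exists>d\<in>C. d \<le> a \<and> d \<le> b" using total[OF that] that by auto
          then obtain d where "d \<in> C" "d \<le> a" "d \<le> b" by blast
          then show ?thesis
            using le[of d "y + z"] sublinear_add[OF sub[of d], of y z]
              by (force simp: le_fun_def dest: spec[of _ y] spec[of _ z])
        qed
        then have "u (y + z) - b z \<le> u y" if "b \<in> C" for b
          using that by (intro ge) (simp add: algebra_simps)
        then have "u (y + z) - u y \<le> u z" by (intro ge) (simp add: algebra_simps)
        then show ?thesis by simp
      qed
      have scale_le: "c * u z \<le> u (c *\<^sub>R z)" if "0 < c" for c z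
        using le that by (intro ge) (simp add: sublinear_scale sub)
      have scale: "u (c *\<^sub>R z) = c * u z" if "0 < c" for c z
        using scale_le[OF that, of z] scale_le[of "inverse c" "c *\<^sub>R z"] that
          by (simp add: field_simps)
      obtain a where "a \<in> C" using False by blast
      then have "u \<le> p" using le ap by (meson le_funI order_trans)
      then have "u \<in> A" using add scale by (auto simp: A_def sublinear_def)
      then show ?thesis using le by (auto simp: le_fun_def)
    qed
  qed
  then show ?thesis using that by (auto simp: A_def intro: order_trans)
qed

text \<open>
  Perturbing \<open>m\<close> along the single direction \<open>y\<close>, with cost \<open>- m y\<close>, yields a smaller sublinear
  functional, hence \<open>m\<close> itself; the resulting inequality \<open>m z \<le> m (z + y) - m y\<close> is the
  missing half of additivity.
\<close>

lemma minimal_sublinear_linear: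
  fixes m :: "'z::real_vector \<Rightarrow> real"
  assumes m: "sublinear m" and min: "\<And>q. sublinear q \<Longrightarrow> q \<le> m \<Longrightarrow> q = m"
  shows "linear m"
proof -
  have add: "m (z + y) = m z + m y" for y z
  proof -
    have "convex_on {y} (\<lambda>_. - m y)" by (simp add: convex_on_const)
    then obtain q where "sublinear q" "q \<le> m"
      and q: "\<And>x z. x \<in> {y} \<Longrightarrow> q z \<le> m (z + id x) + (- m y)"
      by (rule sublinear_perturbation[OF m, where T = id]) (auto simp: linear_id)
    then have "q = m" using min by blast
    then have "m z + m y \<le> m (z + y)" using q[of y z] by simp
    then show ?thesis using sublinear_add[OF m, of z y] by linarith
  qed
  have minus: "m (- z) = - m z" for z
    using add[of z "- z"] sublinear_zero[OF m] by simp
  show ?thesis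
  proof (rule linearI)
    show "m (c *\<^sub>R z) = c *\<^sub>R m z" for c z
    proof (cases c "0::real" rule: linorder_cases)
      case less
      then show ?thesis using sublinear_scale[OF m, of "- c" z] minus[of "c *\<^sub>R z"] by simp
    qed (auto simp: sublinear_zero[OF m] sublinear_scale[OF m])
  qed (rule add)
qed

text \<open>
  The Hahn-Banach theorem in a form that produces multipliers for convex problems: an inequality
  that holds with the sublinear \<open>p\<close> persists for a suitable linear functional below \<open>p\<close>.
\<close>

theorem hahn_banach_lagrange:
  fixes p :: "'z::real_vector \<Rightarrow> real" and T :: "'x::real_vector \<Rightarrow> 'z"
  assumes "sublinear p" "convex_on D k" "D \<noteq> {}" "linear T"
    and "\<And>x. x \<in> D \<Longrightarrow> 0 \<le> p (T x) + k x"
  obtains l where "linear l" "l \<le> p" "\<And>x. x \<in> D \<Longrightarrow> 0 \<le> l (T x) + k x"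
proof -
  obtain q where q: "sublinear q" "q \<le> p" "\<And>x z. x \<in> D \<Longrightarrow> q z \<le> p (z + T x) + k x"
    using sublinear_perturbation[OF assms] by blast
  obtain l where l: "sublinear l" "l \<le> q" "\<And>q. sublinear q \<Longrightarrow> q \<le> l \<Longrightarrow> q = l"
    using minimal_sublinear_exists[OF q(1)] by blast
  have lin: "linear l" by (rule minimal_sublinear_linear[OF l(1) l(3)])
  show ?thesis
  proof
    show "linear l" by fact
    show "l \<le> p" using l(2) q(2) by (rule order_trans)
    show "0 \<le> l (T x) + k x" if "x \<in> D" for x
    proof -
      have "l (- T x) \<le> q (- T x)" using l(2) by (rule le_funD)
      also have "\<dots> \<le> k x" using q(3)[OF that, of "- T x"] by (simp add: sublinear_zero assms(1))
      finally show ?thesis using linear_neg[OF lin, of "T x"] by simp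
    qed
  qed
qed

text \<open>
  Lagrange duality for minimising \<open>k\<close> over \<open>D\<close> subject to \<open>T x = 0\<close>. The value function
  \<open>z \<mapsto> inf {k x | T x = z}\<close> is convex on \<open>F\<close> and bounded above near \<open>0\<close>; such a function
  decreases at most linearly away from \<open>0\<close>, so \<open>k x + K * norm (T x)\<close> is bounded below by
  \<open>m\<close>. \<open>hahn_banach_lagrange\<close> replaces \<open>K * norm\<close> by a linear functional below it; being defined
  on the whole space, it needs no extension from \<open>F\<close>.
\<close>

lemma convex_duality:
  fixes T :: "'x::real_vector \<Rightarrow> 'z::real_normed_vector"
  assumes k: "convex_on D k" and T: "linear T" and F: "subspace F" and TF: "T ` D \<subseteq> F" and "0 < \<epsilon>"
    and bound: "\<And>z. z \<in> F \<Longrightarrow> norm z \<le> \<epsilon> \<Longrightarrow> \<exists>x\<in>D. T x = z \<and> k x \<le> R"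
    and m: "\<And>x. x \<in> D \<Longrightarrow> T x = 0 \<Longrightarrow> m \<le> k x"
  obtains w :: "'z dual" where "\<And>x. x \<in> D \<Longrightarrow> m \<le> k x + w (T x)"
proof -
  interpret T: linear T by fact
  obtain x0 where x0: "x0 \<in> D" "T x0 = 0" "k x0 \<le> R"
    using bound[of 0] subspace_0[OF F] \<open>0 < \<epsilon>\<close> by auto
  have mR: "m \<le> R" using m[OF x0(1,2)] x0(3) by linarith
  define K where "K = (R - m) / \<epsilon>"
  have K: "0 \<le> K" using mR \<open>0 < \<epsilon>\<close> by (simp add: K_def)
  have lip: "0 \<le> K * norm (T x) + (k x - m)" if x: "x \<in> D" for x
  proof (cases "T x = 0")
    case True then show ?thesis using m[OF x] by simp
  next
    case False
    \<comment> \<open>The point \<open>T x\<close> is balanced by a point of norm \<open>\<epsilon>\<close> in the opposite direction.\<close>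
    define n where "n = norm (T x)"
    have n: "0 < n" using False by (simp add: n_def)
    have "- (\<epsilon> / n) *\<^sub>R T x \<in> F" using TF x by (intro subspace_scale[OF F]) auto
    moreover have "norm (- (\<epsilon> / n) *\<^sub>R T x) \<le> \<epsilon>" using n \<open>0 < \<epsilon>\<close> by (simp add: n_def)
    ultimately obtain y where y: "y \<in> D" "T y = - (\<epsilon> / n) *\<^sub>R T x" "k y \<le> R" using bound by blast
    \<comment> \<open>The weights for which the images of \<open>x\<close> and \<open>y\<close> cancel.\<close>
    define u where "u = \<epsilon> / (\<epsilon> + n)"
    define v where "v = n / (\<epsilon> + n)"
    have uv: "0 \<le> u" "0 \<le> v" "u + v = 1"
      using n \<open>0 < \<epsilon>\<close> by (auto simp: u_def v_def simp flip: add_divide_distrib)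
    have "u *\<^sub>R x + v *\<^sub>R y \<in> D" using k uv x y by (auto simp: convex_on_def convex_def)
    moreover have "v * (\<epsilon> / n) = u" using n by (simp add: u_def v_def)
    then have "T (u *\<^sub>R x + v *\<^sub>R y) = 0" by (simp add: T.add T.scaleR y(2))
    ultimately have "m \<le> k (u *\<^sub>R x + v *\<^sub>R y)" by (rule m)
    also have "\<dots> \<le> u * k x + v * k y" using k uv x y by (auto simp: convex_on_def)
    also have "\<dots> \<le> u * k x + v * R" using y(3) uv by (simp add: mult_left_mono)
    finally have "(\<epsilon> + n) * m \<le> (\<epsilon> + n) * (u * k x + v * R)" using n \<open>0 < \<epsilon>\<close> by simp
    also have "\<dots> = \<epsilon> * k x + n * R" using n \<open>0 < \<epsilon>\<close> by (simp add: u_def v_def distrib_left)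
    finally show ?thesis using \<open>0 < \<epsilon>\<close> by (simp add: K_def n_def[symmetric] field_simps)
  qed
  have "sublinear (\<lambda>z::'z. K * norm z)"
    using K by (auto simp: sublinear_def mult_left_mono norm_triangle_ineq simp flip: distrib_left)
  moreover have "convex_on D (\<lambda>x. k x - m)"
    using convex_on_add[OF k, of "\<lambda>_. - m"] k by (simp add: convex_on_const convex_on_def)
  ultimately obtain l where l: "linear l" "l \<le> (\<lambda>z. K * norm z)"
    "\<And>x. x \<in> D \<Longrightarrow> 0 \<le> l (T x) + (k x - m)"
    using hahn_banach_lagrange[of "\<lambda>z::'z. K * norm z" D "\<lambda>x. k x - m" T] x0(1) T lip by blast
  have "\<bar>l z\<bar> \<le> norm z * K" for z
    using le_funD[OF l(2), of z] le_funD[OF l(2), of "- z"] linear_neg[OF l(1), of z]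
    by (simp add: abs_le_iff mult.commute)
  then have "bounded_linear l"
    using l(1) by (intro bounded_linear.intro bounded_linear_axioms.intro) auto
  then have "blinfun_apply (Blinfun l) = l" by (rule bounded_linear_Blinfun_apply)
  then show ?thesis using that[of "Blinfun l"] l(3) by (simp add: algebra_simps)
qed


section \<open>An open mapping principle for convex sets\<close>

text \<open>
  By the Baire category theorem in \<open>F\<close>, the closure of a multiple of some \<open>T ` C n\<close> contains a
  ball of \<open>F\<close> around a point \<open>a\<close>. As \<open>- a\<close> is also a multiple of a point of some \<open>T ` C m\<close>,
  convexity moves the ball to the origin.
\<close>

lemma almost_open_convex_exhaustion:
  fixes T :: "'x::real_vector \<Rightarrow> 'z::banach"
  assumes conv: "\<And>n. convex (C n)" and mono: "\<And>m n. m \<le> n \<Longrightarrow> C m \<subseteq> C n"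
    and T: "linear T" and F: "subspace F" "closed F" and TF: "\<And>n. T ` C n \<subseteq> F"
    and cover: "\<And>z. z \<in> F \<Longrightarrow> \<exists>n. \<exists>l>0. \<exists>x\<in>C n. z = l *\<^sub>R T x"
  obtains N :: nat and \<epsilon> :: real where "0 < \<epsilon>"
    "\<And>z \<eta>. z \<in> F \<Longrightarrow> norm z \<le> \<epsilon> \<Longrightarrow> 0 < \<eta> \<Longrightarrow> \<exists>x\<in>C N. norm (T x - z) < \<eta>"
proof -
  interpret T: linear T by fact
  \<comment> \<open>A point with image \<open>0\<close> makes the scaled sets increasing, so integer factors suffice.\<close>
  obtain n0 l0 x0 where "0 < l0" "x0 \<in> C n0" "0 = l0 *\<^sub>R T x0"
    using cover[OF subspace_0[OF F(1)]] by blast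
  then have x0: "x0 \<in> C n0" "T x0 = 0" by simp_all
  have cover': "\<exists>n. \<exists>x\<in>C n. z = (real n + 1) *\<^sub>R T x" if z: "z \<in> F" for z
  proof -
    obtain n l x where l: "0 < l" and x: "x \<in> C n" "z = l *\<^sub>R T x" using cover[OF z] by blast
    define m where "m = max (max n n0) (nat \<lceil>l\<rceil>)"
    define t where "t = l / (real m + 1)"
    have "l \<le> real m + 1" unfolding m_def by linarith
    then have t: "0 \<le> t" "t \<le> 1" using l by (auto simp: t_def)
    have "n \<le> m" "n0 \<le> m" by (auto simp: m_def)
    then have "x \<in> C m" "x0 \<in> C m" using x x0 mono by blast+
    then have "t *\<^sub>R x + (1 - t) *\<^sub>R x0 \<in> C m" using conv[of m] t by (auto simp: convex_def)
    moreover have "z = (real m + 1) *\<^sub>R T (t *\<^sub>R x + (1 - t) *\<^sub>R x0)"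
      by (simp add: T.add T.scaleR x0(2) x(2) t_def)
    ultimately show ?thesis by (intro exI bexI)
  qed
  define G where "G n = F \<inter> closure ((\<lambda>x. (real n + 1) *\<^sub>R T x) ` C n)" for n
  have "\<exists>n. top_of_set F interior_of G n \<noteq> {}"
  proof (rule ccontr)
    assume none: "\<not> (\<exists>n. top_of_set F interior_of G n \<noteq> {})"
    have "top_of_set F interior_of \<Union>(range G) = {}"
    proof (intro Baire_category_alt disjI1)
      show "completely_metrizable_space (top_of_set F)"
        using F(2) by (intro completely_metrizable_space_closedin completely_metrizable_space_euclidean) simp
      show "countable (range G)" by simp
      show "closedin (top_of_set F) K \<and> top_of_set F interior_of K = {}" if "K \<in> range G" for K
        using that none by (auto simp: G_def intro: closedin_closed_Int)
    qed
    moreover have "\<Union>(range G) = F"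
    proof
      show "F \<subseteq> \<Union>(range G)"
      proof
        fix z assume z: "z \<in> F"
        then obtain n x where "x \<in> C n" "z = (real n + 1) *\<^sub>R T x" using cover' by blast
        then have "z \<in> (\<lambda>x. (real n + 1) *\<^sub>R T x) ` C n" by blast
        from subsetD[OF closure_subset this] have "z \<in> G n" using z by (simp add: G_def)
        then show "z \<in> \<Union>(range G)" by blast
      qed
    qed (auto simp: G_def)
    ultimately have "F = {}" using interior_of_topspace[of "top_of_set F"] by simp
    then show False using subspace_0[OF F(1)] by simp
  qed
  then obtain n U a where U: "openin (top_of_set F) U" "a \<in> U" "U \<subseteq> G n"
    by (auto simp: interior_of_def)
  then obtain \<delta> where \<delta>: "0 < \<delta>" "ball a \<delta> \<inter> F \<subseteq> G n" by (meson openin_contains_ball subset_trans)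
  have aF: "a \<in> F" using U by (auto simp: G_def)
  then obtain m y where y: "y \<in> C m" "- a = (real m + 1) *\<^sub>R T y"
    using cover'[of "- a"] subspace_neg[OF F(1)] by blast
  define N where "N = max n m"
  define c where "c = real n + real m + 2"
  have c: "1 \<le> c" by (simp add: c_def)
  show ?thesis
  proof
    show "0 < \<delta> / (2 * c)" using \<delta> c by simp
    fix z \<eta> assume z: "z \<in> F" "norm z \<le> \<delta> / (2 * c)" and \<eta>: "0 < (\<eta>::real)"
    have "a + c *\<^sub>R z \<in> F" using z aF F(1) by (intro subspace_add subspace_scale)
    moreover have "norm (c *\<^sub>R z) < \<delta>" using z(2) c \<delta>(1) by (simp add: field_simps)
    then have "a + c *\<^sub>R z \<in> ball a \<delta>" by (simp add: dist_norm)
    ultimately have "a + c *\<^sub>R z \<in> closure ((\<lambda>x. (real n + 1) *\<^sub>R T x) ` C n)"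
      using \<delta>(2) by (auto simp: G_def)
    then obtain x where x: "x \<in> C n" "norm ((real n + 1) *\<^sub>R T x - (a + c *\<^sub>R z)) < \<eta>"
      using \<eta> by (auto simp: closure_approachable dist_norm)
    define u where "u = ((real n + 1) / c) *\<^sub>R x + ((real m + 1) / c) *\<^sub>R y"
    have "n \<le> N" "m \<le> N" by (auto simp: N_def)
    then have "x \<in> C N" "y \<in> C N" using x y mono by blast+
    moreover have "(real n + 1) / c + (real m + 1) / c = 1"
      using c by (simp add: c_def flip: add_divide_distrib)
    ultimately have "u \<in> C N" unfolding u_def using c by (intro convexD[OF conv]) auto
    moreover have "norm (T u - z) < \<eta>"
    proof -
      have "c *\<^sub>R (T u - z) = (real n + 1) *\<^sub>R T x + (real m + 1) *\<^sub>R T y - c *\<^sub>R z"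
        using c by (simp add: u_def T.add T.scaleR scaleR_diff_right scaleR_add_right)
      also have "\<dots> = (real n + 1) *\<^sub>R T x - (a + c *\<^sub>R z)" unfolding y(2)[symmetric] by simp
      finally have "norm (c *\<^sub>R (T u - z)) < \<eta>" using x(2) by simp
      moreover have "1 * norm (T u - z) \<le> c * norm (T u - z)"
        using c by (intro mult_right_mono) auto
      ultimately show ?thesis using c by simp
    qed
    ultimately show "\<exists>x\<in>C N. norm (T x - z) < \<eta>" by blast
  qed
qed

text \<open>
  The completeness argument of the open mapping theorem, for a convex set in place of a ball:
  successive halving writes \<open>z\<close> as \<open>\<Sum>k. (1/2) ^ Suc k *\<^sub>R T (a k)\<close> with \<open>a k \<in> C\<close>. The
  weights sum to \<open>1\<close>, so the series \<open>\<Sum>k. (1/2) ^ Suc k *\<^sub>R a k\<close>, which converges because \<open>C\<close>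
  is bounded, has its sum in \<open>C\<close>.
\<close>

lemma convex_image_of_almost_open:
  fixes T :: "'x::banach \<Rightarrow> 'z::real_normed_vector"
  assumes C: "closed C" "bounded C" "convex C" and T: "bounded_linear T"
    and F: "subspace F" and TF: "T ` C \<subseteq> F" and "0 < \<epsilon>"
    and approx: "\<And>z \<eta>. z \<in> F \<Longrightarrow> norm z \<le> \<epsilon> \<Longrightarrow> 0 < \<eta> \<Longrightarrow> \<exists>x\<in>C. norm (T x - z) < \<eta>"
    and z: "z \<in> F" "norm z \<le> \<epsilon> / 2"
  shows "\<exists>x\<in>C. T x = z"
proof -
  interpret T: bounded_linear T by fact
  have "\<exists>x. x \<in> C \<and> norm (2 *\<^sub>R r - T x) \<le> \<epsilon> / 2" if r: "r \<in> F" "norm r \<le> \<epsilon> / 2" for r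
  proof -
    obtain x where "x \<in> C" "norm (T x - 2 *\<^sub>R r) < \<epsilon> / 2"
      using approx[of "2 *\<^sub>R r" "\<epsilon> / 2"] r \<open>0 < \<epsilon>\<close> subspace_scale[OF F] by auto
    then show ?thesis by (metis norm_minus_commute less_imp_le)
  qed
  then obtain pick where pick: "pick r \<in> C" "norm (2 *\<^sub>R r - T (pick r)) \<le> \<epsilon> / 2"
    if "r \<in> F" "norm r \<le> \<epsilon> / 2" for r
    by metis
  define r where "r n = ((\<lambda>r. 2 *\<^sub>R r - T (pick r)) ^^ n) z" for n
  have r0: "r 0 = z" and rSuc: "r (Suc n) = 2 *\<^sub>R r n - T (pick (r n))" for n by (auto simp: r_def)
  have r: "r n \<in> F \<and> norm (r n) \<le> \<epsilon> / 2" for n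
  proof (induction n)
    case (Suc n)
    then have "T (pick (r n)) \<in> F" using pick TF by blast
    then show ?case using Suc pick by (simp add: rSuc subspace_diff subspace_scale F)
  qed (use z in \<open>simp add: r0\<close>)
  define a where "a n = pick (r n)" for n
  have a: "a n \<in> C" for n using pick r by (simp add: a_def)
  define u where "u n = (\<Sum>k<n. (1/2) ^ Suc k *\<^sub>R a k)" for n
  obtain B where B: "norm (a k) \<le> B" for k using C(2) a by (meson bounded_iff)
  have "summable (\<lambda>k. (1/2) ^ Suc k *\<^sub>R a k)"
  proof (rule summable_comparison_test')
    show "summable (\<lambda>k. B * (1/2) ^ k)" by (intro summable_mult summable_geometric) simp
    fix k
    have "norm ((1/2) ^ Suc k *\<^sub>R a k) = (1/2) ^ Suc k * norm (a k)" by simp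
    also have "\<dots> \<le> (1/2) ^ k * B" using B[of k] by (intro mult_mono) auto
    finally show "norm ((1/2) ^ Suc k *\<^sub>R a k) \<le> B * (1/2) ^ k" by (simp add: mult.commute)
  qed
  then obtain s where s: "u \<longlonglongrightarrow> s" unfolding summable_def sums_def u_def by blast
  have half: "(\<lambda>n. (1/2::real) ^ n) \<longlonglongrightarrow> 0" by (rule LIMSEQ_realpow_zero) auto
  \<comment> \<open>The partial sums have total weight \<open>1 - (1/2) ^ n\<close>; any point of \<open>C\<close> can supply the rest.\<close>
  have "u n + (1/2) ^ n *\<^sub>R c \<in> C" if "c \<in> C" for n c
    using that
  proof (induction n arbitrary: c)
    case (Suc n)
    have "(1/2) *\<^sub>R a n + (1/2) *\<^sub>R c \<in> C" using C(3) a Suc.prems by (intro convexD) auto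
    from Suc.IH[OF this] show ?case by (simp add: u_def scaleR_add_right add.assoc mult.commute)
  qed (simp add: u_def)
  moreover have "(\<lambda>n. u n + (1/2) ^ n *\<^sub>R a 0) \<longlonglongrightarrow> s + 0 *\<^sub>R a 0"
    by (intro tendsto_intros s half)
  ultimately have "s \<in> C"
    using C(1) a by (auto intro!: Lim_in_closed_set[where F = sequentially, of C])
  moreover have "T s = z"
  proof (rule LIMSEQ_unique)
    show "(\<lambda>n. T (u n)) \<longlonglongrightarrow> T s" by (rule T.tendsto[OF s])
    have "T (u n) + (1/2) ^ n *\<^sub>R r n = z" for n
    proof (induction n)
      case (Suc n)
      have "T (u (Suc n)) = T (u n) + (1/2) ^ Suc n *\<^sub>R T (a n)"
        by (simp add: u_def T.add T.scaleR)
      moreover have "r (Suc n) = 2 *\<^sub>R r n - T (a n)" by (simp add: rSuc a_def)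
      ultimately show ?case using Suc.IH by (simp add: scaleR_diff_right)
    qed (simp add: u_def r0 T.zero)
    then have eq: "T (u n) = z - (1/2) ^ n *\<^sub>R r n" for n by (metis add_diff_cancel_right')
    have "(\<lambda>n. (1/2) ^ n *\<^sub>R r n) \<longlonglongrightarrow> 0"
    proof (rule Lim_null_comparison)
      have "norm ((1/2) ^ n *\<^sub>R r n) \<le> (1/2) ^ n * (\<epsilon> / 2)" for n
        using r[of n] by (simp add: mult_left_mono)
      then show "\<forall>\<^sub>F n in sequentially. norm ((1/2) ^ n *\<^sub>R r n) \<le> (1/2) ^ n * (\<epsilon> / 2)" by simp
      show "(\<lambda>n. (1/2) ^ n * (\<epsilon> / 2)) \<longlonglongrightarrow> 0" using tendsto_mult_right[OF half] by simp
    qed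
    from tendsto_diff[OF tendsto_const this] show "(\<lambda>n. T (u n)) \<longlonglongrightarrow> z" by (simp add: eq)
  qed
  ultimately show ?thesis by blast
qed

theorem convex_open_mapping:
  fixes T :: "'x::banach \<Rightarrow> 'z::banach"
  assumes C: "\<And>n. closed (C n)" "\<And>n. bounded (C n)" "\<And>n. convex (C n)"
    and mono: "\<And>m n. m \<le> n \<Longrightarrow> C m \<subseteq> C n"
    and T: "bounded_linear T" and F: "subspace F" "closed F" and TF: "\<And>n. T ` C n \<subseteq> F"
    and cover: "\<And>z. z \<in> F \<Longrightarrow> \<exists>n. \<exists>l>0. \<exists>x\<in>C n. z = l *\<^sub>R T x"
  obtains N :: nat and \<epsilon> :: real where "0 < \<epsilon>" "\<And>z. z \<in> F \<Longrightarrow> norm z \<le> \<epsilon> \<Longrightarrow> \<exists>x\<in>C N. T x = z"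
proof -
  obtain N \<epsilon> where "0 < \<epsilon>"
    and approx: "\<And>z \<eta>. z \<in> F \<Longrightarrow> norm z \<le> \<epsilon> \<Longrightarrow> 0 < \<eta> \<Longrightarrow> \<exists>x\<in>C N. norm (T x - z) < \<eta>"
    using almost_open_convex_exhaustion[of C T F, OF C(3) mono bounded_linear.linear[OF T] F TF cover]
      by metis
  show ?thesis
  proof
    show "0 < \<epsilon> / 2" using \<open>0 < \<epsilon>\<close> by simp
    show "\<exists>x\<in>C N. T x = z" if "z \<in> F" "norm z \<le> \<epsilon> / 2" for z
      using convex_image_of_almost_open[OF C T F(1) TF \<open>0 < \<epsilon>\<close> approx that] by blast
  qed
qed


section \<open>The conjugate of a partial episum\<close>

definition strict_epi :: "('b \<Rightarrow> ereal) \<Rightarrow> ('b \<times> real) set" where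
  "strict_epi k = {(b, r). k b < ereal r}"

lemma mem_strict_epi [simp]: "(b, r) \<in> strict_epi k \<longleftrightarrow> k b < ereal r"
  by (simp add: strict_epi_def)

text \<open>
  Strict epigraphs turn extended real convexity into convexity of a set, and below they turn
  statements about conjugates into statements about real numbers.
\<close>

lemma convex_strict_epi:
  assumes "econvex k"
  shows "convex (strict_epi k)"
proof (rule convexI)
  fix p q :: "'a \<times> real" and u v :: real
  assume p: "p \<in> strict_epi k" and q: "q \<in> strict_epi k" and uv: "0 \<le> u" "0 \<le> v" "u + v = 1"
  obtain b r c s where [simp]: "p = (b, r)" "q = (c, s)" by (cases p, cases q) auto
  have lt: "ereal u * k b < ereal (u * r)" if "k b < ereal r" "0 < u" for b r u
    using that by (cases "k b") auto
  have "ereal u * k b + ereal v * k c < ereal (u * r + v * s)"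
  proof (cases "u = 0 \<or> v = 0")
    case True then show ?thesis using p q uv by (auto simp flip: zero_ereal_def)
  next
    case False
    then have "ereal u * k b + ereal v * k c < ereal (u * r) + ereal (v * s)"
      using p q uv by (intro ereal_add_strict_mono2 lt) auto
    then show ?thesis by simp
  qed
  moreover have "k (u *\<^sub>R b + v *\<^sub>R c) \<le> ereal u * k b + ereal v * k c"
    using assms uv by (auto simp: econvex_def)
  ultimately show "u *\<^sub>R p + v *\<^sub>R q \<in> strict_epi k" by auto
qed

lemma convex_sublevel:
  assumes "econvex k"
  shows "convex {b. k b \<le> ereal r}"
proof (rule convexI)
  fix b c and u v :: real
  assume b: "b \<in> {b. k b \<le> ereal r}" "c \<in> {b. k b \<le> ereal r}" and uv: "0 \<le> u" "0 \<le> v" "u + v = 1"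
  have "k (u *\<^sub>R b + v *\<^sub>R c) \<le> ereal u * k b + ereal v * k c"
    using assms uv by (auto simp: econvex_def)
  also have "\<dots> \<le> ereal u * ereal r + ereal v * ereal r"
    using b uv by (intro add_mono ereal_mult_left_mono) auto
  also have "\<dots> = ereal r" using uv by (simp flip: distrib_right)
  finally show "u *\<^sub>R b + v *\<^sub>R c \<in> {b. k b \<le> ereal r}" by simp
qed

lemma closed_sublevel: "lsc k \<Longrightarrow> closed {b. k b \<le> r}"
proof -
  assume k: "lsc k"
  have "open {b. r < k b}"
  proof (subst open_subopen, intro ballI)
    fix b assume "b \<in> {b. r < k b}"
    then have "eventually (\<lambda>c. r < k c) (nhds b)" using k by (auto simp: lsc_def)
    then show "\<exists>U. open U \<and> b \<in> U \<and> U \<subseteq> {b. r < k b}" by (auto simp: eventually_nhds)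
  qed
  moreover have "- {b. k b \<le> r} = {b. r < k b}" by auto
  ultimately show ?thesis by (simp add: closed_def)
qed

text \<open>
  The inequality has to be strict for this: a bound \<open>episum1 f g (x, x') \<le> r\<close> need not be
  witnessed by any decomposition, since the infimum need not be attained. The slack is shared
  equally between the two summands.
\<close>

lemma strict_epi_episum1:
  assumes "\<And>b. f b \<noteq> -\<infinity>" "\<And>b. g b \<noteq> -\<infinity>"
  shows "((x, x'), r) \<in> strict_epi (episum1 f g) \<longleftrightarrow>
    (\<exists>x1 x2 r1 r2. x = x1 + x2 \<and> r = r1 + r2 \<and>
      ((x1, x'), r1) \<in> strict_epi f \<and> ((x2, x'), r2) \<in> strict_epi g)" (is "?L \<longleftrightarrow> ?R")
proof
  assume ?L
  then obtain \<xi> where \<xi>: "f (x - \<xi>, x') + g (\<xi>, x') < ereal r"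
    by (auto simp: episum1_def INF_less_iff)
  obtain a where a: "f (x - \<xi>, x') = ereal a"
    using \<xi> assms by (cases "f (x - \<xi>, x')") auto
  obtain b where b: "g (\<xi>, x') = ereal b"
    using \<xi> assms by (cases "g (\<xi>, x')") auto
  have "a + b < r" using \<xi> a b by simp
  then have "((x - \<xi>, x'), a + (r - a - b) / 2) \<in> strict_epi f"
    "((\<xi>, x'), b + (r - a - b) / 2) \<in> strict_epi g"
    "x = (x - \<xi>) + \<xi>" "r = (a + (r - a - b) / 2) + (b + (r - a - b) / 2)"
    using a b by (auto simp: field_simps)
  then show ?R by blast
next
  assume ?R
  then obtain x1 x2 r1 r2 where r: "x = x1 + x2" "r = r1 + r2" "f (x1, x') < ereal r1"
    "g (x2, x') < ereal r2"
    by auto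
  then have "f (x1, x') + g (x2, x') < ereal r1 + ereal r2"
    by (intro ereal_add_strict_mono2)
  then have "f (x - x2, x') + g (x2, x') < ereal r" using r by simp
  then show ?L by (auto simp: episum1_def INF_less_iff)
qed

lemma convex_strict_epi_episum1:
  assumes "\<And>b. f b \<noteq> -\<infinity>" "\<And>b. g b \<noteq> -\<infinity>" "convex (strict_epi f)" "convex (strict_epi g)"
  shows "convex (strict_epi (episum1 f g))"
proof (rule convexI)
  fix p q :: "('a \<times> 'a dual) \<times> real" and u v :: real
  assume p: "p \<in> strict_epi (episum1 f g)" and q: "q \<in> strict_epi (episum1 f g)"
    and uv: "0 \<le> u" "0 \<le> v" "u + v = 1"
  obtain x x' r y y' s where [simp]: "p = ((x, x'), r)" "q = ((y, y'), s)"
    by (cases p, cases q) auto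
  obtain x1 x2 r1 r2 where 1: "x = x1 + x2" "r = r1 + r2" "((x1, x'), r1) \<in> strict_epi f"
    "((x2, x'), r2) \<in> strict_epi g"
    using p unfolding \<open>p = _\<close> strict_epi_episum1[OF assms(1,2)] by blast
  obtain y1 y2 s1 s2 where 2: "y = y1 + y2" "s = s1 + s2" "((y1, y'), s1) \<in> strict_epi f"
    "((y2, y'), s2) \<in> strict_epi g"
    using q unfolding \<open>q = _\<close> strict_epi_episum1[OF assms(1,2)] by blast
  have "u *\<^sub>R ((x1, x'), r1) + v *\<^sub>R ((y1, y'), s1) \<in> strict_epi f"
    using assms(3) 1 2 uv by (intro convexD)
  moreover have "u *\<^sub>R ((x2, x'), r2) + v *\<^sub>R ((y2, y'), s2) \<in> strict_epi g"
    using assms(4) 1 2 uv by (intro convexD)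
  moreover have "u *\<^sub>R p + v *\<^sub>R q = ((u *\<^sub>R x + v *\<^sub>R y, u *\<^sub>R x' + v *\<^sub>R y'), u * r + v * s)"
    by simp
  moreover have "u *\<^sub>R x + v *\<^sub>R y = (u *\<^sub>R x1 + v *\<^sub>R y1) + (u *\<^sub>R x2 + v *\<^sub>R y2)"
    "u * r + v * s = (u * r1 + v * s1) + (u * r2 + v * s2)"
    by (auto simp: 1 2 algebra_simps)
  ultimately show "u *\<^sub>R p + v *\<^sub>R q \<in> strict_epi (episum1 f g)"
    unfolding \<open>p = _\<close> \<open>q = _\<close>
      by (simp only: strict_epi_episum1[OF assms(1,2)] scaleR_Pair add_Pair real_scaleR_def) blast
qed

text \<open>
  The form in which conjugates are used throughout. It holds for all \<open>k\<close>, also where \<open>k\<close> is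
  infinite: points with value \<open>\<infinity>\<close> contribute nothing on either side, and a value \<open>-\<infinity>\<close> makes both
  sides false.
\<close>

lemma conjugate_le_iff:
  "conjugate k (y', y'') \<le> ereal M \<longleftrightarrow>
    (\<forall>x x' r. ((x, x'), r) \<in> strict_epi k \<longrightarrow> blinfun_apply y' x + blinfun_apply y'' x' - r \<le> M)"
proof -
  have *: "ereal a - t \<le> ereal M \<longleftrightarrow> (\<forall>r. t < ereal r \<longrightarrow> a - r \<le> M)" for a t
  proof (cases t)
    case (real b)
    have "(\<forall>r. b < r \<longrightarrow> a - r \<le> M) \<longleftrightarrow> a - M \<le> b"
      by (metis dense_ge_bounded diff_le_eq add.commute dense_ge le_less_trans less_imp_le not_less)
    then show ?thesis using real by auto
  next
    case MInf
    have "\<not> a - (a - M - 1) \<le> M" by simp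
    then show ?thesis using MInf by (auto intro!: exI[of _ "a - M - 1"])
  qed simp
  show ?thesis unfolding conjugate_def by (auto simp: SUP_le_iff * )
qed

lemma ereal_le_if_real_bounds:
  assumes "\<And>M. s \<le> ereal M \<Longrightarrow> q \<le> M"
  shows "ereal q \<le> s"
proof (cases s)
  case MInf
  then show ?thesis using assms[of "q - 1"] by simp
qed (use assms in auto)

lemma conjugate_episum1_le:
  assumes "\<And>b. f b \<noteq> -\<infinity>" "\<And>b. g b \<noteq> -\<infinity>"
    and "conjugate f (y', u'') \<le> ereal A" "conjugate g (y', v'') \<le> ereal B"
  shows "conjugate (episum1 f g) (y', u'' + v'') \<le> ereal (A + B)"
  unfolding conjugate_le_iff strict_epi_episum1[OF assms(1,2)]
proof (intro allI impI, elim exE conjE)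
  fix x x' r x1 x2 r1 r2
  assume *: "x = x1 + x2" "r = r1 + r2" "((x1, x'), r1) \<in> strict_epi f"
    "((x2, x'), r2) \<in> strict_epi g"
  have "blinfun_apply y' x1 + blinfun_apply u'' x' - r1 \<le> A"
    "blinfun_apply y' x2 + blinfun_apply v'' x' - r2 \<le> B"
    using assms(3,4) * unfolding conjugate_le_iff by blast+
  then show "blinfun_apply y' x + blinfun_apply (u'' + v'') x' - r \<le> A + B"
    using * by (simp add: blinfun.add_right blinfun.add_left)
qed

text \<open>
  The sets of pairs \<open>(p, q)\<close> on which both norms and both values are at most \<open>n\<close> are closed (by
  lower semicontinuity), bounded and convex, and they exhaust the product of the domains. The open
  mapping principle applies to \<open>(p, q) \<mapsto> snd p - snd q\<close>. It is important that one \<open>n\<close> bounds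
  the values and the norms simultaneously: this bounds the value function of the next lemma.
\<close>

lemma domain_difference_open:
  fixes f g :: "'a::banach \<times> 'a dual \<Rightarrow> ereal"
  defines "F \<equiv> \<Union>l\<in>{0<..}. {l *\<^sub>R (s - t) |s t. s \<in> snd ` eff_dom f \<and> t \<in> snd ` eff_dom g}"
  assumes f: "\<And>b. f b \<noteq> -\<infinity>" "econvex f" "lsc f" and g: "\<And>b. g b \<noteq> -\<infinity>" "econvex g" "lsc g"
    and F: "subspace F" "closed F"
  obtains n :: nat and \<epsilon> :: real where "0 < \<epsilon>"
    "\<And>z. z \<in> F \<Longrightarrow> norm z \<le> \<epsilon> \<Longrightarrow> \<exists>p q. norm p \<le> n \<and> norm q \<le> n \<and>
       f p \<le> ereal n \<and> g q \<le> ereal n \<and> snd p - snd q = z"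
proof -
  define C where "C n = (cball 0 (real n) \<inter> {p. f p \<le> ereal (real n)}) \<times>
    (cball 0 (real n) \<inter> {q. g q \<le> ereal (real n)})" for n
  define T where "T x = snd (fst x) - snd (snd x)" for x :: "('a \<times> 'a dual) \<times> ('a \<times> 'a dual)"
  have C: "(p, q) \<in> C n \<longleftrightarrow> norm p \<le> real n \<and> norm q \<le> real n \<and>
    f p \<le> ereal (real n) \<and> g q \<le> ereal (real n)" for p q n
    by (auto simp: C_def)
  have F_iff: "z \<in> F \<longleftrightarrow> (\<exists>l>0. \<exists>p\<in>eff_dom f. \<exists>q\<in>eff_dom g. z = l *\<^sub>R (snd p - snd q))" for z
    unfolding F_def by fastforce
  obtain N \<epsilon> where "0 < \<epsilon>" and N: "\<And>z. z \<in> F \<Longrightarrow> norm z \<le> \<epsilon> \<Longrightarrow> \<exists>x\<in>C N. T x = z"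
  proof (rule convex_open_mapping[of C T F])
    show "closed (C n)" for n
      unfolding C_def using f g by (intro closed_Times closed_Int closed_sublevel closed_cball)
    show "bounded (C n)" for n
      unfolding C_def by (intro bounded_Times bounded_Int disjI1 bounded_cball)
    show "convex (C n)" for n
      unfolding C_def using f g by (intro convex_Times convex_Int convex_sublevel convex_cball)
    show "C m \<subseteq> C n" if "m \<le> n" for m n
    proof
      fix x assume "x \<in> C m"
      moreover obtain p q where "x = (p, q)" by (cases x)
      moreover have "real m \<le> real n" "ereal (real m) \<le> ereal (real n)" using that by auto
      ultimately show "x \<in> C n" by (auto simp: C intro: order_trans)
    qed
    show "bounded_linear T"
      unfolding T_def by (intro bounded_linear_sub bounded_linear_compose[OF bounded_linear_snd]
          bounded_linear_fst bounded_linear_snd)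
    show "T ` C n \<subseteq> F" for n
    proof (clarify)
      fix p q assume pq: "(p, q) \<in> C n"
      have "p \<in> eff_dom f" "q \<in> eff_dom g"
        using pq f(1)[of p] g(1)[of q] by (auto simp: C eff_dom_def)
      moreover have "T (p, q) = 1 *\<^sub>R (snd p - snd q)" by (simp add: T_def)
      ultimately show "T (p, q) \<in> F" unfolding F_iff using zero_less_one by blast
    qed
    show "\<exists>n. \<exists>l>0. \<exists>x\<in>C n. z = l *\<^sub>R T x" if z: "z \<in> F" for z
    proof -
      obtain l p q where l: "0 < l" and pq: "p \<in> eff_dom f" "q \<in> eff_dom g"
        "z = l *\<^sub>R (snd p - snd q)"
        using z unfolding F_iff by blast
      obtain a b where ab: "f p = ereal a" "g q = ereal b" using pq by (auto simp: eff_dom_def)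
      obtain n where "max (max (norm p) (norm q)) (max a b) \<le> real n"
        using real_arch_simple by blast
      then have "(p, q) \<in> C n" by (simp add: C ab)
      moreover have "z = l *\<^sub>R T (p, q)" by (simp add: T_def pq)
      ultimately show ?thesis using l by blast
    qed
  qed (use F in auto)
  show ?thesis
  proof
    show "0 < \<epsilon>" by fact
    fix z assume z: "z \<in> F" "norm z \<le> \<epsilon>"
    obtain x where x: "x \<in> C N" "T x = z" using N[OF z] by blast
    obtain p q where "x = (p, q)" by (cases x)
    then show "\<exists>p q. norm p \<le> real N \<and> norm q \<le> real N \<and>
       f p \<le> ereal (real N) \<and> g q \<le> ereal (real N) \<and> snd p - snd q = z"
      using x by (intro exI[of _ p] exI[of _ q]) (auto simp: C T_def)
  qed
qed

text \<open>
  The bound \<open>M\<close> says that \<open>r1 + r2 - \<langle>x1 + x2, y'\<rangle> - \<langle>s, y''\<rangle> \<ge> - M\<close> whenever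
  \<open>((x1, s), r1)\<close> and \<open>((x2, t), r2)\<close> lie in the strict epigraphs of \<open>f\<close> and \<open>g\<close> and
  \<open>s - t = 0\<close>. A multiplier \<open>w\<close> for this constraint removes it at the price of the term
  \<open>\<langle>s - t, w\<rangle>\<close>, and then the two halves separate: \<open>y'' - w\<close> goes to \<open>f\<close> and \<open>w\<close> goes to \<open>g\<close>.
\<close>

lemma conjugate_episum1_split:
  fixes f g :: "'a::banach \<times> 'a dual \<Rightarrow> ereal"
  defines "F \<equiv> \<Union>l\<in>{0<..}. {l *\<^sub>R (s - t) |s t. s \<in> snd ` eff_dom f \<and> t \<in> snd ` eff_dom g}"
  assumes f: "\<And>b. f b \<noteq> -\<infinity>" "econvex f" "lsc f" and g: "\<And>b. g b \<noteq> -\<infinity>" "econvex g" "lsc g"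
    and F: "subspace F" "closed F"
    and M: "conjugate (episum1 f g) (y', y'') \<le> ereal M"
  obtains u'' v'' A B where "u'' + v'' = y''" "A + B \<le> M"
    "conjugate f (y', u'') \<le> ereal A" "conjugate g (y', v'') \<le> ereal B"
proof -
  obtain n \<epsilon> where "0 < \<epsilon>" and n: "\<And>z. z \<in> F \<Longrightarrow> norm z \<le> \<epsilon> \<Longrightarrow> \<exists>p q. norm p \<le> real n \<and>
      norm q \<le> real n \<and> f p \<le> ereal (real n) \<and> g q \<le> ereal (real n) \<and> snd p - snd q = z"
    by (rule domain_difference_open[OF f g F[unfolded F_def], folded F_def]) (rule that, assumption, blast)
  define D where "D = strict_epi f \<times> strict_epi g"
  define T where "T x = snd (fst (fst x)) - snd (fst (snd x))"
    for x :: "(('a \<times> 'a dual) \<times> real) \<times> (('a \<times> 'a dual) \<times> real)"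
  define k where "k x = snd (fst x) + snd (snd x) -
      blinfun_apply y' (fst (fst (fst x)) + fst (fst (snd x))) - blinfun_apply y'' (snd (fst (fst x)))"
    for x :: "(('a \<times> 'a dual) \<times> real) \<times> (('a \<times> 'a dual) \<times> real)"
  \<comment> \<open>The slack \<open>1\<close> on each level makes the points lie in the strict epigraphs.\<close>
  define R where "R = 2 * (real n + 1) + norm y' * (2 * real n) + norm y'' * real n"
  have fin: "p \<in> eff_dom f" if "f p < ereal r" for p r
    using that f(1)[of p] by (cases "f p") (auto simp: eff_dom_def)
  have gin: "p \<in> eff_dom g" if "g p < ereal r" for p r
    using that g(1)[of p] by (cases "g p") (auto simp: eff_dom_def)
  obtain w :: "'a dual dual" where w: "\<And>x. x \<in> D \<Longrightarrow> - M \<le> k x + w (T x)"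
  proof (rule convex_duality[of D k T F \<epsilon> R "- M"])
    have D: "convex D" unfolding D_def using f g by (intro convex_Times convex_strict_epi)
    show "linear T" unfolding T_def by (intro linearI) (auto simp: scaleR_diff_right)
    have "linear k" unfolding k_def
      by (intro linearI) (auto simp: blinfun.add_right blinfun.scaleR_right algebra_simps)
    then show "convex_on D k" using D by (auto simp: convex_on_def linear_add linear_scale)
    show "subspace F" "0 < \<epsilon>" by fact+
    show "T ` D \<subseteq> F"
    proof
      fix z assume "z \<in> T ` D"
      then obtain p r q s where pq: "z = 1 *\<^sub>R (snd p - snd q)" "f p < ereal r" "g q < ereal s"
        by (auto simp: D_def T_def)
      then have "snd p \<in> snd ` eff_dom f" "snd q \<in> snd ` eff_dom g" using fin gin by blast+
      then have "z \<in> {1 *\<^sub>R (s - t) |s t. s \<in> snd ` eff_dom f \<and> t \<in> snd ` eff_dom g}"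
        using pq(1) by blast
      then show "z \<in> F" unfolding F_def by (rule UN_I[rotated]) simp
    qed
    show "- M \<le> k x" if "x \<in> D" "T x = 0" for x
    proof -
      obtain x1 s r1 x2 t r2 where x: "x = (((x1, s), r1), ((x2, t), r2))" by (metis surj_pair)
      then have st: "s = t" using that by (simp add: T_def)
      then have "((x1 + x2, s), r1 + r2) \<in> strict_epi (episum1 f g)"
        using that x f g unfolding strict_epi_episum1[OF f(1) g(1)] D_def by blast
      then have "blinfun_apply y' (x1 + x2) + blinfun_apply y'' s - (r1 + r2) \<le> M"
        using M unfolding conjugate_le_iff by blast
      then show ?thesis by (simp add: k_def x)
    qed
    show "\<exists>x\<in>D. T x = z \<and> k x \<le> R" if z: "z \<in> F" "norm z \<le> \<epsilon>" for z
    proof -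
      obtain p q where pq: "norm p \<le> real n" "norm q \<le> real n" "f p \<le> ereal (real n)"
        "g q \<le> ereal (real n)"
        "snd p - snd q = z" using n[OF z] by blast
      define x where "x = ((p, real n + 1), (q, real n + 1))"
      have "f p < ereal (real n + 1)" "g q < ereal (real n + 1)"
        using pq by (auto intro: le_less_trans)
      then have "x \<in> D" by (simp add: D_def x_def)
      moreover have "T x = z" using pq by (simp add: T_def x_def)
      moreover have "k x \<le> R"
      proof -
        have p: "norm (fst p) \<le> real n" "norm (snd p) \<le> real n"
          using pq norm_fst_le[of "fst p" "snd p"] norm_snd_le[of "snd p" "fst p"] by auto
        have q: "norm (fst q) \<le> real n"
          using pq norm_fst_le[of "fst q" "snd q"] by auto
        have "\<bar>blinfun_apply y' (fst p + fst q)\<bar> \<le> norm y' * norm (fst p + fst q)"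
          using norm_blinfun[of y' "fst p + fst q"] by simp
        also have "\<dots> \<le> norm y' * (2 * real n)"
          using p q norm_triangle_ineq[of "fst p" "fst q"] by (intro mult_left_mono) auto
        finally have "\<bar>blinfun_apply y' (fst p + fst q)\<bar> \<le> norm y' * (2 * real n)" .
        moreover have "\<bar>blinfun_apply y'' (snd p)\<bar> \<le> norm y'' * norm (snd p)"
          using norm_blinfun[of y'' "snd p"] by simp
        then have "\<bar>blinfun_apply y'' (snd p)\<bar> \<le> norm y'' * real n"
          by (rule order_trans) (use p in \<open>auto intro: mult_left_mono\<close>)
        ultimately show ?thesis by (simp add: k_def x_def R_def)
      qed
      ultimately show ?thesis by blast
    qed
  qed blast
  have split: "(blinfun_apply y' x1 + blinfun_apply (y'' - w) s - r1) +
      (blinfun_apply y' x2 + blinfun_apply w t - r2) \<le> M"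
    if "((x1, s), r1) \<in> strict_epi f" "((x2, t), r2) \<in> strict_epi g" for x1 s r1 x2 t r2
    using w[of "(((x1, s), r1), ((x2, t), r2))"] that
    by (simp add: D_def k_def T_def blinfun.add_right blinfun.diff_left blinfun.diff_right)
  \<comment> \<open>A sum of two independent terms is at most \<open>M\<close>, so the supremum of the first one separates them.\<close>
  define V where "V = (\<lambda>((x, s), r). blinfun_apply y' x + blinfun_apply (y'' - w) s - r) ` strict_epi f"
  obtain p q where "f p \<le> ereal (real n)" "g q \<le> ereal (real n)"
    using n[OF subspace_0[OF F(1)]] \<open>0 < \<epsilon>\<close> by auto
  then have "(p, real n + 1) \<in> strict_epi f" "(q, real n + 1) \<in> strict_epi g"
    by (auto intro: le_less_trans)
  then obtain x2 t r2 where e: "((x2, t), r2) \<in> strict_epi g" and "strict_epi f \<noteq> {}"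
    by (metis surj_pair empty_iff)
  then have V: "V \<noteq> {}" by (simp add: V_def)
  have "v \<le> M - (blinfun_apply y' x2 + blinfun_apply w t - r2)" if "v \<in> V" for v
    using that split[OF _ e] unfolding V_def by (fastforce simp: algebra_simps)
  then have bdd: "bdd_above V" by (rule bdd_aboveI)
  show ?thesis
  proof
    show "(y'' - w) + w = y''" by simp
    show "Sup V + (M - Sup V) \<le> M" by simp
    show "conjugate f (y', y'' - w) \<le> ereal (Sup V)" unfolding conjugate_le_iff
    proof (intro allI impI)
      fix x s r assume "((x, s), r) \<in> strict_epi f"
      then have "blinfun_apply y' x + blinfun_apply (y'' - w) s - r \<in> V"
        unfolding V_def by (rule rev_image_eqI) simp
      then show "blinfun_apply y' x + blinfun_apply (y'' - w) s - r \<le> Sup V"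
        using bdd by (rule cSup_upper)
    qed
    show "conjugate g (y', w) \<le> ereal (M - Sup V)" unfolding conjugate_le_iff
    proof (intro allI impI)
      fix x s r assume *: "((x, s), r) \<in> strict_epi g"
      have "Sup V \<le> M - (blinfun_apply y' x + blinfun_apply w s - r)"
        using V
      proof (rule cSup_least)
        show "v \<le> M - (blinfun_apply y' x + blinfun_apply w s - r)" if "v \<in> V" for v
          using that split[OF _ *] unfolding V_def by (fastforce simp: algebra_simps)
      qed
      then show "blinfun_apply y' x + blinfun_apply w s - r \<le> M - Sup V" by simp
    qed
  qed
qed


section \<open>The quadratic forms on the product with the dual\<close>

text \<open>The symmetric bilinear form with \<open>qL_pair b b = 2 * qL b\<close>.\<close>

definition qL_pair :: "'a::real_normed_vector \<times> 'a dual \<Rightarrow> 'a \<times> 'a dual \<Rightarrow> real" where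
  "qL_pair b c = blinfun_apply (snd c) (fst b) + blinfun_apply (snd b) (fst c)"

text \<open>\<open>rL (b - c)\<close> is the expression in the definition of quasidensity, at points \<open>b\<close> and \<open>c\<close>.\<close>

definition rL :: "'a::real_normed_vector \<times> 'a dual \<Rightarrow> real" where
  "rL b = (norm b)\<^sup>2 / 2 + qL b"

lemma norm_square_pair: "(norm b)\<^sup>2 = (norm (fst b))\<^sup>2 + (norm (snd b))\<^sup>2"
  by (cases b) (simp add: norm_Pair)

lemma qL_add: "qL (b + c) = qL b + qL_pair b c + qL c"
  by (simp add: qL_def qL_pair_def blinfun.add_left blinfun.add_right)

lemma qL_diff: "qL (b - c) = qL b - qL_pair b c + qL c"
  by (simp add: qL_def qL_pair_def blinfun.diff_left blinfun.diff_right)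

lemma qL_scaleR: "qL (t *\<^sub>R b) = t\<^sup>2 * qL b"
  by (simp add: qL_def blinfun.scaleR_left blinfun.scaleR_right power2_eq_square)

lemma qL_pair_scaleR: "qL_pair (s *\<^sub>R b) (t *\<^sub>R c) = s * t * qL_pair b c"
  by (simp add: qL_pair_def blinfun.scaleR_left blinfun.scaleR_right algebra_simps)

lemma qL_pair_commute: "qL_pair b c = qL_pair c b"
  by (simp add: qL_pair_def)

lemma abs_qL_pair_le: "\<bar>qL_pair b c\<bar> \<le> norm b * norm c"
proof -
  have "\<bar>qL_pair b c\<bar> \<le> norm (snd c) * norm (fst b) + norm (snd b) * norm (fst c)"
    unfolding qL_pair_def
      using norm_blinfun[of "snd c" "fst b"] norm_blinfun[of "snd b" "fst c"] by simp
  also have "\<dots> = norm (fst b) * norm (snd c) + norm (snd b) * norm (fst c)" by simp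
  also have "\<dots> \<le> sqrt ((norm (fst b))\<^sup>2 + (norm (snd b))\<^sup>2) * sqrt ((norm (snd c))\<^sup>2 + (norm (fst c))\<^sup>2)"
    using Cauchy_Schwarz_ineq2[of "(norm (fst b), norm (snd b))" "(norm (snd c), norm (fst c))"]
    by (simp add: norm_Pair)
  also have "\<dots> = norm b * norm c" by (cases b; cases c) (simp add: norm_Pair add.commute)
  finally show ?thesis .
qed

lemma abs_qL_le: "\<bar>qL b\<bar> \<le> (norm b)\<^sup>2 / 2"
proof -
  have "qL_pair b b = 2 * qL b" by (simp add: qL_pair_def qL_def)
  then show ?thesis using abs_qL_pair_le[of b b] by (simp add: power2_eq_square)
qed

lemma rL_nonneg: "0 \<le> rL b"
  using abs_qL_le[of b] by (simp add: rL_def)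

lemma continuous_qL: "continuous_on UNIV qL"
  unfolding qL_def by (intro continuous_intros)

lemma tendsto_qL: "(b \<longlongrightarrow> c) F \<Longrightarrow> ((\<lambda>n. qL (b n)) \<longlongrightarrow> qL c) F"
  by (rule continuous_on_tendsto_compose[OF continuous_qL]) auto

lemma quasidense_iff:
  "quasidense A \<longleftrightarrow> (\<forall>c. \<forall>e>0. \<exists>b\<in>A. rL (b - c) < e)"
proof -
  have eq: "1/2 * (norm (s - x))\<^sup>2 + 1/2 * (norm (s' - x'))\<^sup>2 + blinfun_apply (s' - x') (s - x) =
    rL ((s, s') - (x, x'))" for s x :: 'a and s' x'
    by (simp add: rL_def norm_square_pair[of "(_, _)"] qL_def)
  have "quasidense A \<longleftrightarrow> (\<forall>x x'. (INF b\<in>A. ereal (rL (b - (x, x')))) \<le> 0)"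
    unfolding quasidense_def eq by (simp add: case_prod_beta' del: diff_Pair)
  then have "quasidense A \<longleftrightarrow> (\<forall>c. (INF b\<in>A. ereal (rL (b - c))) \<le> 0)" by auto
  moreover have "(INF b\<in>A. ereal (rL (b - c))) \<le> 0 \<longleftrightarrow> (\<forall>e>0. \<exists>b\<in>A. rL (b - c) < e)" for c
  proof
    assume "(INF b\<in>A. ereal (rL (b - c))) \<le> 0"
    then have "(INF b\<in>A. ereal (rL (b - c))) < ereal e" if "0 < e" for e
      using that by (simp add: le_less_trans)
    then show "\<forall>e>0. \<exists>b\<in>A. rL (b - c) < e" by (simp add: INF_less_iff)
  next
    assume *: "\<forall>e>0. \<exists>b\<in>A. rL (b - c) < e"
    show "(INF b\<in>A. ereal (rL (b - c))) \<le> 0"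
    proof (rule ereal_le_epsilon2)
      fix e :: real assume "0 < e"
      then obtain b where "b \<in> A" "rL (b - c) < e" using * by blast
      then show "(INF b\<in>A. ereal (rL (b - c))) \<le> 0 + ereal e" by (intro INF_lower2[of b]) auto
    qed
  qed
  ultimately show ?thesis by simp
qed

text \<open>
  The infimum of \<open>(norm e)\<^sup>2 / 2 + w e\<close> is \<open>- (norm w)\<^sup>2 / 2\<close>; it is approached along
  vectors \<open>e\<close> with \<open>norm e = norm w\<close> on which \<open>w\<close> almost attains \<open>- norm w * norm e\<close>.
\<close>

lemma half_square_plus_functional:
  fixes w :: "'a::real_normed_vector dual"
  assumes "0 < \<epsilon>"
  obtains e where "(norm e)\<^sup>2 / 2 + blinfun_apply w e < - (norm w)\<^sup>2 / 2 + \<epsilon>"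
proof (cases "w = 0")
  case True then show ?thesis using that[of 0] assms by simp
next
  case False
  define n where "n = norm w"
  have n: "0 < n" using False by (simp add: n_def)
  have "\<exists>x. (n - \<epsilon> / (2 * n)) * norm x < norm (blinfun_apply w x)"
  proof (rule ccontr)
    assume "\<not> ?thesis"
    then have le: "norm (blinfun_apply w x) \<le> (n - \<epsilon> / (2 * n)) * norm x" for x
      by (simp add: not_less)
    then have "norm (blinfun_apply w x) \<le> max 0 (n - \<epsilon> / (2 * n)) * norm x" for x
      by (rule order_trans) (auto intro: mult_right_mono)
    then have "n \<le> max 0 (n - \<epsilon> / (2 * n))" unfolding n_def[symmetric]
      using norm_blinfun_bound[of "max 0 (n - \<epsilon> / (2 * n))" w] by (simp add: n_def)
    moreover have "0 < \<epsilon> / (2 * n)" using n assms by simp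
    ultimately show False using n by linarith
  qed
  then obtain x where x: "(n - \<epsilon> / (2 * n)) * norm x < \<bar>blinfun_apply w x\<bar>" by auto
  then have "x \<noteq> 0" by auto
  define s where "s = (if 0 \<le> blinfun_apply w x then 1 else - 1 :: real)"
  have s: "s * blinfun_apply w x = \<bar>blinfun_apply w x\<bar>" "\<bar>s\<bar> = 1" by (auto simp: s_def)
  define e where "e = - (s * n / norm x) *\<^sub>R x"
  have "norm e = n" using \<open>x \<noteq> 0\<close> s n by (simp add: e_def abs_mult)
  moreover have "blinfun_apply w e = - n * (s * blinfun_apply w x) / norm x"
    by (simp add: e_def blinfun.scaleR_right blinfun.minus_right)
  then have "blinfun_apply w e = - n * (\<bar>blinfun_apply w x\<bar> / norm x)" unfolding s by simp
  moreover have "n - \<epsilon> / (2 * n) < \<bar>blinfun_apply w x\<bar> / norm x"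
    using x \<open>x \<noteq> 0\<close> by (simp add: less_divide_eq)
  then have "n * (n - \<epsilon> / (2 * n)) < n * (\<bar>blinfun_apply w x\<bar> / norm x)"
    using n by (intro mult_strict_left_mono)
  then have "n\<^sup>2 - \<epsilon> / 2 < n * (\<bar>blinfun_apply w x\<bar> / norm x)"
    using n by (simp add: right_diff_distrib power2_eq_square)
  ultimately have "(norm e)\<^sup>2 / 2 + blinfun_apply w e < - n\<^sup>2 / 2 + \<epsilon>" using assms by simp
  then show ?thesis using that by (simp add: n_def)
qed

section \<open>Quasidensity and lower bounds for the conjugate\<close>

text \<open>
  A point \<open>b\<close> of \<open>coinc k\<close> gives \<open>k\<^sup>*(d) \<ge> \<langle>b, d\<rangle> - q\<^sub>L b\<close>, and the right-hand side is the
  pairing at \<open>d = (y', y'')\<close> minus the pairing at \<open>d - L b\<close>, where \<open>L\<close> embeds \<open>E \<times> E'\<close> in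
  its dual. So \<open>b\<close> has to be chosen with the pairing at \<open>d - L b\<close> almost nonpositive. First
  \<open>(0, y' - e)\<close> is chosen so that \<open>(norm e)\<^sup>2 / 2 + (norm y'')\<^sup>2 / 2 + \<langle>e, y''\<rangle>\<close> is
  small, then \<open>b\<close> by quasidensity with respect to that point. In both steps the half squares of the
  norms absorb the mixed terms.
\<close>

lemma conjugate_ge_of_quasidense_coinc:
  fixes k :: "'a::real_normed_vector \<times> 'a dual \<Rightarrow> ereal"
  assumes "quasidense (coinc k)"
  shows "ereal (blinfun_apply y'' y') \<le> conjugate k (y', y'')"
proof (rule ereal_le_if_real_bounds)
  fix M assume M: "conjugate k (y', y'') \<le> ereal M"
  have "blinfun_apply y'' y' \<le> M + \<epsilon>" if "0 < \<epsilon>" for \<epsilon>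
  proof -
    obtain e where e: "(norm e)\<^sup>2 / 2 + blinfun_apply y'' e < - (norm y'')\<^sup>2 / 2 + \<epsilon> / 2"
      using half_square_plus_functional[of "\<epsilon> / 2"] \<open>0 < \<epsilon>\<close> by auto
    obtain b where b: "b \<in> coinc k" "rL (b - (0, y' - e)) < \<epsilon> / 2"
      using assms \<open>0 < \<epsilon>\<close> unfolding quasidense_iff by (meson half_gt_zero)
    obtain s a where sa: "b - (0, y' - e) = (s, a)" by (cases "b - (0, y' - e)")
    have b': "b = (s, y' - e + a)" using sa by (simp add: diff_eq_eq add.commute)
    have r: "(norm s)\<^sup>2 / 2 + (norm a)\<^sup>2 / 2 + blinfun_apply a s < \<epsilon> / 2"
      using b(2) unfolding sa rL_def
        by (simp add: norm_square_pair[of "(_, _)"] qL_def add_divide_distrib)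
    have "ereal (blinfun_apply y' s + blinfun_apply y'' (y' - e + a)) - k b \<le> conjugate k (y', y'')"
      unfolding conjugate_def b' by (simp add: SUP_upper2[of "(s, y' - e + a)"])
    moreover have "k b = ereal (blinfun_apply (y' - e + a) s)"
      using b(1) by (simp add: coinc_def qL_def b')
    ultimately have "blinfun_apply y' s + blinfun_apply y'' (y' - e + a) - blinfun_apply (y' - e + a) s \<le> M"
      using M order_trans by fastforce
    then have "blinfun_apply y'' y' \<le> M + blinfun_apply y'' e - blinfun_apply y'' a - blinfun_apply e s + blinfun_apply a s"
      by (simp add: blinfun.add_left blinfun.add_right blinfun.diff_left blinfun.diff_right)
    moreover have "- blinfun_apply y'' a \<le> norm y'' * norm a"
      "- blinfun_apply e s \<le> norm e * norm s"
      using norm_blinfun[of y'' a] norm_blinfun[of e s] by auto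
    moreover have "2 * (norm y'' * norm a) \<le> (norm y'')\<^sup>2 + (norm a)\<^sup>2"
      "2 * (norm e * norm s) \<le> (norm e)\<^sup>2 + (norm s)\<^sup>2"
      using sum_squares_bound[of "norm y''" "norm a"] sum_squares_bound[of "norm e" "norm s"]
        by (auto simp: mult.assoc)
    ultimately show ?thesis using e r by linarith
  qed
  then show "blinfun_apply y'' y' \<le> M" by (rule field_le_epsilon)
qed

lemma convex_on_half_norm_square:
  fixes c :: "'b::real_normed_vector"
  shows "convex_on UNIV (\<lambda>d. (norm (d - c))\<^sup>2 / 2)"
  unfolding convex_on_def
proof (intro conjI ballI allI impI)
  fix x y :: 'b and u v :: real assume uv: "0 \<le> u" "0 \<le> v" "u + v = 1"
  define a b where "a = norm (x - c)" and "b = norm (y - c)"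
  have v: "v = 1 - u" using uv by simp
  have "u *\<^sub>R x + v *\<^sub>R y - c = u *\<^sub>R (x - c) + v *\<^sub>R (y - c)" by (simp add: v algebra_simps)
  then have "norm (u *\<^sub>R x + v *\<^sub>R y - c) \<le> u * a + v * b"
    using norm_triangle_ineq[of "u *\<^sub>R (x - c)" "v *\<^sub>R (y - c)"] uv by (simp add: a_def b_def)
  then have "(norm (u *\<^sub>R x + v *\<^sub>R y - c))\<^sup>2 \<le> (u * a + v * b)\<^sup>2" by (rule power_mono) simp
  also have "\<dots> = u * a\<^sup>2 + v * b\<^sup>2 - u * v * (a - b)\<^sup>2" unfolding v by algebra
  also have "\<dots> \<le> u * a\<^sup>2 + v * b\<^sup>2" using uv by simp
  finally show "(norm (u *\<^sub>R x + v *\<^sub>R y - c))\<^sup>2 / 2 \<le> u * ((norm (x - c))\<^sup>2 / 2) + v * ((norm (y - c))\<^sup>2 / 2)"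
    by (simp add: a_def b_def)
qed simp


section \<open>Approximate and exact coincidence points\<close>

lemma at_conj_le_iff:
  "at_conj k b \<le> ereal M \<longleftrightarrow> (\<forall>a s. (a, s) \<in> strict_epi k \<longrightarrow> qL_pair a b - s \<le> M)"
  by (cases b) (simp add: at_conj_def conjugate_le_iff qL_pair_def)

text \<open>
  The term \<open>r - q\<^sub>L b + r\<^sub>L (b - c)\<close> equals
  \<open>r - qL_pair b c + q\<^sub>L c + (norm (b - c))\<^sup>2 / 2\<close>: the quadratic parts of \<open>q\<^sub>L\<close>
  cancel and a convex problem in \<open>(b, r)\<close> is left. Were its infimum at least \<open>\<epsilon>\<close>, duality would
  decouple the point at which the norm is evaluated from \<open>b\<close> and produce a functional
  \<open>w = (w1, w2)\<close> for which \<open>k\<^sup>*\<close> at \<open>L c - w\<close> is too small to be at least the pairing there.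
  Since \<open>norm w1 * norm w2 \<ge> - \<langle>w1, w2\<rangle>\<close>, this is impossible.
\<close>

lemma approximate_coincidence_of_conjugate_ge:
  fixes k :: "'a::real_normed_vector \<times> 'a dual \<Rightarrow> ereal"
  assumes k: "convex (strict_epi k)" "strict_epi k \<noteq> {}"
    and conj: "\<And>y' y''. ereal (blinfun_apply y'' y') \<le> conjugate k (y', y'')" and "0 < \<epsilon>"
  obtains b r where "(b, r) \<in> strict_epi k" "r - qL b + rL (b - c) < \<epsilon>"
proof (rule ccontr)
  note near = that
  assume "\<not> thesis"
  then have far: "\<epsilon> \<le> r - qL b + rL (b - c)" if mem: "(b, r) \<in> strict_epi k" for b r
    using near[OF mem] by (meson not_less)
  obtain b0 r0 where b0: "(b0, r0) \<in> strict_epi k" using k(2) by (metis surj_pair ex_in_conv)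
  define D where "D = strict_epi k \<times> (UNIV :: ('a \<times> 'a dual) set)"
  define T where "T x = fst (fst x) - snd x" for x :: "(('a \<times> 'a dual) \<times> real) \<times> ('a \<times> 'a dual)"
  define h where "h x = (snd (fst x) - qL_pair (fst (fst x)) c) + (qL c + (norm (snd x - c))\<^sup>2 / 2)"
    for x :: "(('a \<times> 'a dual) \<times> real) \<times> ('a \<times> 'a dual)"
  \<comment> \<open>The value of \<open>h\<close> stays bounded if only the second argument moves, by norm at most \<open>1\<close>.\<close>
  define R where "R = r0 - qL_pair b0 c + qL c + (norm (b0 - c) + 1)\<^sup>2 / 2"
  obtain w :: "('a \<times> 'a dual) dual" where w: "\<And>x. x \<in> D \<Longrightarrow> \<epsilon> \<le> h x + w (T x)"
  proof (rule convex_duality[of D h T UNIV 1 R \<epsilon>])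
    have D: "convex D" unfolding D_def using k by (intro convex_Times) auto
    show "linear T" unfolding T_def by (intro linearI) (auto simp: scaleR_diff_right)
    show "convex_on D h"
      unfolding convex_on_def
    proof (intro conjI D ballI allI impI)
      fix x y and u v :: real assume uv: "0 \<le> u" "0 \<le> v" "u + v = 1"
      define l where "l x = snd (fst x) - qL_pair (fst (fst x)) c"
        for x :: "(('a \<times> 'a dual) \<times> real) \<times> ('a \<times> 'a dual)"
      have hl: "h x = l x + (qL c + (norm (snd x - c))\<^sup>2 / 2)" for x by (simp add: h_def l_def)
      have "l (u *\<^sub>R x + v *\<^sub>R y) = u * l x + v * l y"
        by (simp add: l_def qL_pair_def blinfun.add_left blinfun.add_right blinfun.scaleR_left
            blinfun.scaleR_right algebra_simps)
      moreover have "(norm (u *\<^sub>R snd x + v *\<^sub>R snd y - c))\<^sup>2 / 2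
          \<le> u * ((norm (snd x - c))\<^sup>2 / 2) + v * ((norm (snd y - c))\<^sup>2 / 2)"
        using convex_on_half_norm_square[of c] uv unfolding convex_on_def by blast
      moreover have "u * qL c + v * qL c = qL c" using uv by (simp flip: distrib_right)
      ultimately show "h (u *\<^sub>R x + v *\<^sub>R y) \<le> u * h x + v * h y"
        by (simp add: hl distrib_left)
    qed
    show "\<epsilon> \<le> h x" if "x \<in> D" "T x = 0" for x
    proof -
      obtain b r d where x: "x = ((b, r), d)" by (metis surj_pair)
      then have "d = b" "(b, r) \<in> strict_epi k" using that by (auto simp: D_def T_def)
      then show ?thesis using far[of b r] by (simp add: x h_def rL_def qL_diff)
    qed
    show "\<exists>x\<in>D. T x = z \<and> h x \<le> R" if "norm z \<le> 1" for z
    proof (intro bexI conjI)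
      show "((b0, r0), b0 - z) \<in> D" using b0 by (simp add: D_def)
      show "T ((b0, r0), b0 - z) = z" by (simp add: T_def)
      have "norm (b0 - z - c) \<le> norm (b0 - c) + 1"
        using norm_triangle_ineq4[of "b0 - c" z] that by (simp add: algebra_simps)
      then have "(norm (b0 - z - c))\<^sup>2 \<le> (norm (b0 - c) + 1)\<^sup>2" by (rule power_mono) simp
      then show "h ((b0, r0), b0 - z) \<le> R" by (simp add: h_def R_def)
    qed
  qed (auto intro: subspace_UNIV)
  define w1 where "w1 = Blinfun (\<lambda>x. blinfun_apply w (x, 0))"
  define w2 where "w2 = Blinfun (\<lambda>x'. blinfun_apply w (0, x'))"
  have bl: "bounded_linear (\<lambda>x. (x, 0::'a dual))" "bounded_linear (\<lambda>x'. (0::'a, x'))"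
    by (intro bounded_linear_Pair bounded_linear_ident bounded_linear_zero)+
  have "blinfun_apply w1 = (\<lambda>x. blinfun_apply w (x, 0))"
    unfolding w1_def
    by (intro bounded_linear_Blinfun_apply bounded_linear_compose[OF blinfun.bounded_linear_right bl(1)])
  moreover have "blinfun_apply w2 = (\<lambda>x'. blinfun_apply w (0, x'))"
    unfolding w2_def
    by (intro bounded_linear_Blinfun_apply bounded_linear_compose[OF blinfun.bounded_linear_right bl(2)])
  ultimately have w12: "blinfun_apply w1 x = blinfun_apply w (x, 0)"
    "blinfun_apply w2 x' = blinfun_apply w (0, x')" for x x'
    by simp_all
  have wsum: "blinfun_apply w (x, x') = blinfun_apply w1 x + blinfun_apply w2 x'" for x x'
    by (simp add: w12 flip: blinfun.add_right)
  \<comment> \<open>The choice of \<open>d\<close> that makes the estimate of \<open>k\<^sup>*\<close> sharpest.\<close>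
  obtain e1 where e1: "(norm e1)\<^sup>2 / 2 + blinfun_apply (- w1) e1 < - (norm (- w1))\<^sup>2 / 2 + \<epsilon> / 2"
    using half_square_plus_functional[of "\<epsilon> / 2"] \<open>0 < \<epsilon>\<close> by (meson half_gt_zero)
  obtain e2 where e2: "(norm e2)\<^sup>2 / 2 + blinfun_apply (- w2) e2 < - (norm (- w2))\<^sup>2 / 2 + \<epsilon> / 2"
    using half_square_plus_functional[of "\<epsilon> / 2"] \<open>0 < \<epsilon>\<close> by (meson half_gt_zero)
  define e where "e = (e1, e2)"
  \<comment> \<open>The bound on the conjugate obtained by putting \<open>d = c + e\<close> in the inequality for \<open>w\<close>.\<close>
  define M where "M = qL c + (norm e)\<^sup>2 / 2 - blinfun_apply w e - blinfun_apply w c - \<epsilon>"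
  have "conjugate k (snd c - w1, canon (fst c) - w2) \<le> ereal M"
    unfolding conjugate_le_iff
  proof (intro allI impI)
    fix x x' r assume "((x, x'), r) \<in> strict_epi k"
    then have "(((x, x'), r), c + e) \<in> D" by (simp add: D_def)
    from w[OF this]
    show "blinfun_apply (snd c - w1) x + blinfun_apply (canon (fst c) - w2) x' - r \<le> M"
      by (simp add: h_def T_def M_def qL_pair_def wsum blinfun.diff_left blinfun.diff_right blinfun.add_right del: diff_Pair)
  qed
  with conj[of "canon (fst c) - w2" "snd c - w1"]
  have "blinfun_apply (canon (fst c) - w2) (snd c - w1) \<le> M" by (metis ereal_less_eq(3) order_trans)
  moreover have "blinfun_apply w c = blinfun_apply w1 (fst c) + blinfun_apply w2 (snd c)"
    using wsum[of "fst c" "snd c"] by simp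
  ultimately have "blinfun_apply w2 w1 \<le> (norm e)\<^sup>2 / 2 - blinfun_apply w e - \<epsilon>"
    by (simp add: M_def qL_def blinfun.diff_left blinfun.diff_right)
  also have "\<dots> = (norm e1)\<^sup>2 / 2 + (norm e2)\<^sup>2 / 2 - blinfun_apply w1 e1 - blinfun_apply w2 e2 - \<epsilon>"
    unfolding norm_square_pair[of e] by (simp add: e_def wsum add_divide_distrib)
  finally have "blinfun_apply w2 w1 < - (norm w1)\<^sup>2 / 2 - (norm w2)\<^sup>2 / 2"
    using e1 e2 by (simp add: blinfun.minus_left)
  moreover have "- blinfun_apply w2 w1 \<le> norm w2 * norm w1" using norm_blinfun[of w2 w1] by simp
  moreover have "2 * (norm w2 * norm w1) \<le> (norm w2)\<^sup>2 + (norm w1)\<^sup>2"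
    using sum_squares_bound[of "norm w2" "norm w1"] by (simp add: mult.assoc)
  ultimately show False by linarith
qed

context
  fixes k :: "'a::real_normed_vector \<times> 'a dual \<Rightarrow> ereal"
  assumes convex: "convex (strict_epi k)" and ge: "\<And>b. ereal (qL b) \<le> k b"
begin

lemma strict_epi_ge_qL: "(b, r) \<in> strict_epi k \<Longrightarrow> qL b \<le> r"
  using ge[of b] by (metis le_less_trans ereal_less_eq(3) less_imp_le mem_strict_epi)

text \<open>
  Convexity together with the domination of \<open>q\<^sub>L\<close>, at the point of the segment with parameter \<open>t\<close>;
  the left-hand side is \<open>q\<^sub>L\<close> at that point.
\<close>

lemma strict_epi_segment:
  assumes "(b, r) \<in> strict_epi k" "(c, s) \<in> strict_epi k" "0 \<le> t" "t \<le> 1"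
  shows "(1 - t) * qL b + t * qL c - t * (1 - t) * qL (b - c) \<le> (1 - t) * r + t * s"
proof -
  have "(1 - t) *\<^sub>R (b, r) + t *\<^sub>R (c, s) \<in> strict_epi k"
    using assms by (intro convexD[OF convex]) auto
  then have "((1 - t) *\<^sub>R b + t *\<^sub>R c, (1 - t) * r + t * s) \<in> strict_epi k" by simp
  then have "qL ((1 - t) *\<^sub>R b + t *\<^sub>R c) \<le> (1 - t) * r + t * s" by (rule strict_epi_ge_qL)
  moreover have "qL ((1 - t) *\<^sub>R b + t *\<^sub>R c) = (1 - t)\<^sup>2 * qL b + (1 - t) * t * qL_pair b c + t\<^sup>2 * qL c"
    by (simp add: qL_add qL_scaleR qL_pair_scaleR)
  moreover have "\<dots> = (1 - t) * qL b + t * qL c - t * (1 - t) * qL (b - c)"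
    unfolding qL_diff by algebra
  ultimately show ?thesis by simp
qed

text \<open>
  Approximate coincidence points are almost monotonically related. This is what turns smallness of
  \<open>r\<^sub>L\<close> at a difference into smallness of its norm.
\<close>

lemma minus_qL_diff_le:
  assumes "(b, r) \<in> strict_epi k" "(c, s) \<in> strict_epi k"
  shows "- qL (b - c) \<le> 2 * (r - qL b) + 2 * (s - qL c)"
  using strict_epi_segment[OF assms, of "1/2"] by simp

text \<open>
  If \<open>k\<close> had the value \<open>q\<^sub>L c\<close> at the limit \<open>c\<close>, then \<open>k - q\<^sub>L\<close> would attain its minimum there,
  and the first order condition in the direction of \<open>a\<close> would read
  \<open>qL_pair a c - k a \<le> q\<^sub>L c\<close>. Using the segment inequality along the sequence, and passing
  to the limit first in the sequence and then in \<open>t \<rightarrow> 0\<close>, this remains true although \<open>k c\<close> itself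
  may be larger.
\<close>

lemma at_conj_le_qL_of_limit:
  assumes br: "\<And>n. (b n, r n) \<in> strict_epi k" and b: "b \<longlonglongrightarrow> c"
    and r: "(\<lambda>n. r n - qL (b n)) \<longlonglongrightarrow> 0"
  shows "at_conj k c \<le> ereal (qL c)"
proof -
  have q: "(\<lambda>n. qL (b n)) \<longlonglongrightarrow> qL c" using b by (rule tendsto_qL)
  have r': "r \<longlonglongrightarrow> qL c" using tendsto_add[OF r q] by simp
  have "qL_pair a c - s \<le> qL c" if as: "(a, s) \<in> strict_epi k" for a s
  proof -
    have seg: "qL a - (1 - t) * qL (c - a) \<le> s" if t: "0 < t" "t \<le> 1" for t
    proof -
      have "(1 - t) * qL c + t * qL a - t * (1 - t) * qL (c - a) \<le> (1 - t) * qL c + t * s"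
      proof (rule LIMSEQ_le)
        show "(\<lambda>n. (1 - t) * qL (b n) + t * qL a - t * (1 - t) * qL (b n - a))
          \<longlonglongrightarrow> (1 - t) * qL c + t * qL a - t * (1 - t) * qL (c - a)"
          by (intro tendsto_intros q tendsto_qL b)
        show "(\<lambda>n. (1 - t) * r n + t * s) \<longlonglongrightarrow> (1 - t) * qL c + t * s"
          by (intro tendsto_intros r')
        show "\<exists>N. \<forall>n\<ge>N. (1 - t) * qL (b n) + t * qL a - t * (1 - t) * qL (b n - a) \<le> (1 - t) * r n + t * s"
          using strict_epi_segment[OF br as] t by auto
      qed
      then have "t * (qL a - (1 - t) * qL (c - a)) \<le> t * s" by (simp add: algebra_simps)
      then show ?thesis using t by simp
    qed
    have "qL a - (1 - 0) * qL (c - a) \<le> s"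
    proof (rule LIMSEQ_le)
      have "(\<lambda>n. 1 / (real n + 1)) \<longlonglongrightarrow> 0"
        using LIMSEQ_inverse_real_of_nat by (simp add: inverse_eq_divide add.commute)
      then show "(\<lambda>n. qL a - (1 - 1 / (real n + 1)) * qL (c - a)) \<longlonglongrightarrow> qL a - (1 - 0) * qL (c - a)"
        by (intro tendsto_intros)
      show "\<exists>N. \<forall>n\<ge>N. qL a - (1 - 1 / (real n + 1)) * qL (c - a) \<le> s" using seg by auto
    qed (rule tendsto_const)
    then show ?thesis by (simp add: qL_diff qL_pair_commute)
  qed
  then show ?thesis unfolding at_conj_le_iff by blast
qed

end

text \<open>
  From a point with gap \<open>r - q\<^sub>L b < \<delta> n\<close> one passes to an approximate coincidence point \<open>c\<close>
  with respect to \<open>b\<close>, with tolerance \<open>\<delta> (Suc n) = \<delta> n / 4\<close>. The almost monotonicity of both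
  points gives \<open>(norm (c - b))\<^sup>2 / 2 < 3 * \<delta> (Suc n) + 2 * \<delta> n\<close>, so the steps have
  length at most \<open>3 * \<eta> / 2 ^ n\<close> and sum to at most \<open>6 * \<eta>\<close>.
\<close>

lemma coincidence_near_approximate_coincidence:
  fixes k :: "'a::banach \<times> 'a dual \<Rightarrow> ereal"
  assumes k: "convex (strict_epi k)" "strict_epi k \<noteq> {}" and ge: "\<And>b. ereal (qL b) \<le> k b"
    and conj: "\<And>y' y''. ereal (blinfun_apply y'' y') \<le> conjugate k (y', y'')"
    and br: "(b, r) \<in> strict_epi k" "r - qL b < \<eta>\<^sup>2" and "0 < \<eta>"
  obtains c where "at_conj k c \<le> ereal (qL c)" "norm (c - b) \<le> 6 * \<eta>"
proof -
  define \<delta> where "\<delta> n = (\<eta> / 2 ^ n)\<^sup>2" for n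
  define P where "P n p \<longleftrightarrow> p \<in> strict_epi k \<and> snd p - qL (fst p) < \<delta> n" for n p
  have \<delta>: "0 < \<delta> n" for n using \<open>0 < \<eta>\<close> by (simp add: \<delta>_def)
  have step: "\<exists>q. P (Suc n) q \<and> norm (fst q - fst p) \<le> 3 * \<eta> / 2 ^ n" if p: "P n p" for n p
  proof -
    obtain b r where [simp]: "p = (b, r)" by (cases p)
    obtain c s where cs: "(c, s) \<in> strict_epi k" "s - qL c + rL (c - b) < \<delta> (Suc n)"
      using approximate_coincidence_of_conjugate_ge[OF k conj \<delta>[of "Suc n"], of b] by blast
    have pk: "(b, r) \<in> strict_epi k" "r - qL b < \<delta> n" using p by (auto simp: P_def)
    have *: "qL c \<le> s" using strict_epi_ge_qL[OF k(1) ge] cs by blast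
    have P: "P (Suc n) (c, s)" using cs rL_nonneg[of "c - b"] by (simp add: P_def)
    have "(norm (c - b))\<^sup>2 / 2 < \<delta> (Suc n) - qL (c - b)" using cs * by (simp add: rL_def)
    moreover have "- qL (c - b) \<le> 2 * (s - qL c) + 2 * (r - qL b)"
      by (rule minus_qL_diff_le[OF k(1) ge cs(1) pk(1)])
    moreover have "s - qL c < \<delta> (Suc n)" using P by (simp add: P_def)
    ultimately have "(norm (c - b))\<^sup>2 / 2 < 3 * \<delta> (Suc n) + 2 * \<delta> n" using pk(2) by (smt (verit))
    also have "\<delta> (Suc n) = \<delta> n / 4" by (simp add: \<delta>_def power2_eq_square)
    finally have "(norm (c - b))\<^sup>2 \<le> 9 * \<delta> n" using \<delta>[of n] by simp
    also have "\<dots> = (3 * \<eta> / 2 ^ n)\<^sup>2" by (simp add: \<delta>_def power2_eq_square)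
    finally have "norm (c - b) \<le> 3 * \<eta> / 2 ^ n" by (rule power2_le_imp_le) (use \<open>0 < \<eta>\<close> in auto)
    then show ?thesis using P by (intro exI[of _ "(c, s)"]) simp
  qed
  have "\<exists>N. \<forall>n p. P n p \<longrightarrow>
      P (Suc n) (N n p) \<and> norm (fst (N n p) - fst p) \<le> 3 * \<eta> / 2 ^ n"
    using step by metis
  then obtain N where nxt: "\<And>n p. P n p \<Longrightarrow>
      P (Suc n) (N n p) \<and> norm (fst (N n p) - fst p) \<le> 3 * \<eta> / 2 ^ n"
    by blast
  define p where "p = rec_nat (b, r) N"
  have p0: "p 0 = (b, r)" and pSuc: "p (Suc n) = N n (p n)" for n by (simp_all add: p_def)
  have pP: "P n (p n)" for n
  proof (induction n)
    case 0 show ?case using br by (simp add: p0 P_def \<delta>_def)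
  next
    case (Suc n) then show ?case using nxt by (simp add: pSuc)
  qed
  have pstep: "norm (fst (p (Suc n)) - fst (p n)) \<le> 3 * \<eta> / 2 ^ n" for n
    using nxt[OF pP[of n]] by (simp add: pSuc)
  define d where "d n = fst (p (Suc n)) - fst (p n)" for n
  have geo: "(\<lambda>n. 3 * \<eta> * (1/2) ^ n) sums (3 * \<eta> * 2)"
    using sums_mult[OF geometric_sums[of "1/2::real"], of "3 * \<eta>"] by simp
  have dle: "norm (d n) \<le> 3 * \<eta> * (1/2) ^ n" for n
    using pstep[of n] by (simp add: d_def power_divide)
  have sn: "summable (\<lambda>n. norm (d n))"
    by (rule summable_comparison_test'[OF sums_summable[OF geo]]) (simp add: dle)
  have "norm (suminf d) \<le> (\<Sum>n. norm (d n))" by (rule summable_norm[OF sn])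
  also have "\<dots> \<le> (\<Sum>n. 3 * \<eta> * (1/2) ^ n)"
    by (rule suminf_le[OF dle sn sums_summable[OF geo]])
  also have "\<dots> = 6 * \<eta>" using sums_unique[OF geo] by simp
  finally have "norm (suminf d) \<le> 6 * \<eta>" .
  moreover have "(\<lambda>n. b + sum d {..<n}) \<longlonglongrightarrow> b + suminf d"
    by (intro tendsto_add tendsto_const summable_LIMSEQ[OF summable_norm_cancel[OF sn]])
  moreover have "b + sum d {..<n} = fst (p n)" for n
    using sum_lessThan_telescope[of "\<lambda>n. fst (p n)" n] by (simp add: d_def p0)
  ultimately have lim: "(\<lambda>n. fst (p n)) \<longlonglongrightarrow> b + suminf d" and bd: "norm (suminf d) \<le> 6 * \<eta>"
    by simp_all
  have "at_conj k (b + suminf d) \<le> ereal (qL (b + suminf d))"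
  proof (rule at_conj_le_qL_of_limit[OF k(1) ge _ lim])
    show *: "(fst (p n), snd (p n)) \<in> strict_epi k" for n using pP[of n] by (simp add: P_def)
    have "(\<lambda>n. \<eta> * (1/2) ^ n) \<longlonglongrightarrow> \<eta> * 0" by (intro tendsto_intros LIMSEQ_realpow_zero) auto
    then have "(\<lambda>n. (\<eta> * (1/2) ^ n)\<^sup>2) \<longlonglongrightarrow> 0"
      using tendsto_power[of "\<lambda>n. \<eta> * (1/2) ^ n" 0 sequentially 2] by simp
    moreover have "\<delta> = (\<lambda>n. (\<eta> * (1/2) ^ n)\<^sup>2)" by (simp add: \<delta>_def power_divide fun_eq_iff)
    ultimately have lim0: "\<delta> \<longlonglongrightarrow> 0" by simp
    show "(\<lambda>n. snd (p n) - qL (fst (p n))) \<longlonglongrightarrow> 0"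
    proof (rule tendsto_sandwich[OF _ _ tendsto_const lim0])
      show "\<forall>\<^sub>F n in sequentially. 0 \<le> snd (p n) - qL (fst (p n))"
        using strict_epi_ge_qL[OF k(1) ge *] by (simp add: diff_ge_0_iff_ge)
      show "\<forall>\<^sub>F n in sequentially. snd (p n) - qL (fst (p n)) \<le> \<delta> n"
        using pP by (auto simp: P_def less_imp_le)
    qed
  qed
  then show ?thesis using that[of "b + suminf d"] bd by simp
qed

text \<open>
  An approximate coincidence point \<open>b\<close> with \<open>r\<^sub>L (b - c)\<close> small is moved by at most \<open>6 * \<eta>\<close> to
  a coincidence point \<open>a\<close> of \<open>k\<^sup>@\<close>. To see that \<open>r\<^sub>L (a - c)\<close> is still small, \<open>norm (b - c)\<close>
  must be bounded independently of \<open>\<eta>\<close>. The bound \<open>m0 + Q\<close> follows from comparing \<open>b\<close> with one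
  fixed point \<open>b0\<close> of the domain by almost monotonicity.
\<close>

theorem quasidense_coinc_at_conj:
  fixes k :: "'a::banach \<times> 'a dual \<Rightarrow> ereal"
  assumes k: "convex (strict_epi k)" "strict_epi k \<noteq> {}" and ge: "\<And>b. ereal (qL b) \<le> k b"
    and conj: "\<And>y' y''. ereal (blinfun_apply y'' y') \<le> conjugate k (y', y'')"
  shows "quasidense (coinc (at_conj k))"
  unfolding quasidense_iff
proof (intro allI impI)
  fix c :: "'a \<times> 'a dual" and \<epsilon> :: real assume "0 < \<epsilon>"
  obtain b0 r0 where b0: "(b0, r0) \<in> strict_epi k" using k(2) by (metis surj_pair ex_in_conv)
  define \<beta> where "\<beta> = r0 - qL b0"
  define m0 where "m0 = norm (b0 - c)"
  define Q where "Q = 6 + 4 * \<beta> + 4 * m0\<^sup>2"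
  \<comment> \<open>With this \<open>L\<close>, the final estimate of \<open>rL (a - c)\<close> is \<open>L * \<eta>\<close>.\<close>
  define L where "L = 37 + 12 * (m0 + Q)"
  define \<eta> where "\<eta> = min 1 (\<epsilon> / (2 * L))"
  have \<beta>: "0 \<le> \<beta>" using strict_epi_ge_qL[OF k(1) ge b0] by (simp add: \<beta>_def)
  have Q: "1 \<le> Q" "0 \<le> m0" using \<beta> by (auto simp: Q_def m0_def)
  have L: "0 < L" using Q by (simp add: L_def)
  have \<eta>: "0 < \<eta>" "\<eta> \<le> 1" "L * \<eta> < \<epsilon>"
  proof -
    show "0 < \<eta>" "\<eta> \<le> 1" using L \<open>0 < \<epsilon>\<close> by (auto simp: \<eta>_def)
    have "L * \<eta> \<le> L * (\<epsilon> / (2 * L))" using L by (intro mult_left_mono) (auto simp: \<eta>_def)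
    also have "\<dots> < \<epsilon>" using L \<open>0 < \<epsilon>\<close> by simp
    finally show "L * \<eta> < \<epsilon>" .
  qed
  have \<eta>2: "\<eta>\<^sup>2 \<le> \<eta>" using \<eta> by (simp add: power2_eq_square mult_left_le)
  obtain b r where br: "(b, r) \<in> strict_epi k" "r - qL b + rL (b - c) < \<eta>\<^sup>2"
    using approximate_coincidence_of_conjugate_ge[OF k conj, of "\<eta>\<^sup>2" c] zero_less_power[OF \<eta>(1), of 2]
      by blast
  have qr: "qL b \<le> r" using strict_epi_ge_qL[OF k(1) ge br(1)] .
  have gap: "r - qL b < \<eta>\<^sup>2" "rL (b - c) < \<eta>\<^sup>2" using br qr rL_nonneg[of "b - c"] by auto
  define m where "m = norm (b - c)"
  have m: "m \<le> m0 + Q"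
  proof -
    have "- qL (b - b0) \<le> 2 * (r - qL b) + 2 * \<beta>"
      unfolding \<beta>_def by (rule minus_qL_diff_le[OF k(1) ge br(1) b0])
    moreover have "qL (b - c) = qL (b - b0) + qL_pair (b - b0) (b0 - c) + qL (b0 - c)"
      using qL_add[of "b - b0" "b0 - c"] by simp
    moreover have "- qL_pair (b - b0) (b0 - c) \<le> (m + m0) * m0"
    proof -
      have "norm (b - b0) \<le> m + m0"
        using norm_triangle_ineq4[of "b - c" "b0 - c"] by (simp add: m_def m0_def)
      then have "norm (b - b0) * norm (b0 - c) \<le> (m + m0) * m0"
        unfolding m0_def by (intro mult_right_mono) auto
      then show ?thesis using abs_qL_pair_le[of "b - b0" "b0 - c"] by linarith
    qed
    moreover have "- qL (b0 - c) \<le> m0\<^sup>2 / 2" unfolding m0_def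
      using abs_qL_le[of "b0 - c"] by linarith
    moreover have "m\<^sup>2 / 2 + qL (b - c) < 1" using gap(2) \<eta>2 \<eta> by (simp add: rL_def m_def)
    moreover have "r - qL b \<le> 1" using gap(1) \<eta>2 \<eta> by linarith
    ultimately have "m\<^sup>2 / 2 < 1 + 2 + 2 * \<beta> + (m + m0) * m0 + m0\<^sup>2 / 2" by (smt (verit))
    then have "(m - m0)\<^sup>2 < Q" by (simp add: Q_def power2_eq_square algebra_simps)
    also have "Q \<le> Q\<^sup>2" using Q by (simp add: power2_eq_square)
    finally have "(m - m0)\<^sup>2 \<le> Q\<^sup>2" by simp
    then have "m - m0 \<le> Q" by (rule power2_le_imp_le) (use Q in simp)
    then show ?thesis by simp
  qed
  obtain a where a: "at_conj k a \<le> ereal (qL a)" "norm (a - b) \<le> 6 * \<eta>"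
    using coincidence_near_approximate_coincidence[OF k ge conj br(1) gap(1) \<eta>(1)] by blast
  have "ereal (qL a) \<le> at_conj k a"
    using conj[of "canon (fst a)" "snd a"] by (simp add: at_conj_def case_prod_beta' qL_def)
  then have "a \<in> coinc (at_conj k)" using a(1) by (simp add: coinc_def)
  moreover have "rL (a - c) < \<epsilon>"
  proof -
    have n: "norm (a - c) \<le> m + 6 * \<eta>"
      using norm_triangle_ineq[of "a - b" "b - c"] a(2) by (simp add: m_def)
    have m0: "0 \<le> m" by (simp add: m_def)
    have "(norm (a - c))\<^sup>2 \<le> (m + 6 * \<eta>)\<^sup>2" using n by (rule power_mono) simp
    moreover have "qL (a - c) = qL (a - b) + qL_pair (a - b) (b - c) + qL (b - c)"
      using qL_add[of "a - b" "b - c"] by simp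
    moreover have "\<bar>qL_pair (a - b) (b - c)\<bar> \<le> 6 * \<eta> * m"
      using abs_qL_pair_le[of "a - b" "b - c"] mult_right_mono[OF a(2) m0] by (simp add: m_def)
    moreover have "(norm (a - b))\<^sup>2 \<le> (6 * \<eta>)\<^sup>2" using a(2) by (rule power_mono) simp
    then have "\<bar>qL (a - b)\<bar> \<le> (6 * \<eta>)\<^sup>2 / 2" using abs_qL_le[of "a - b"] by linarith
    ultimately have "rL (a - c) \<le> (m + 6 * \<eta>)\<^sup>2 / 2 + (6 * \<eta>)\<^sup>2 / 2 + 6 * \<eta> * m + qL (b - c)"
      unfolding rL_def by linarith
    also have "\<dots> = rL (b - c) + 12 * (\<eta> * m) + 36 * \<eta>\<^sup>2"
      by (simp add: rL_def m_def power2_eq_square algebra_simps)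
    also have "\<dots> \<le> \<eta> + 12 * (\<eta> * (m0 + Q)) + 36 * \<eta>"
      using gap(2) \<eta>2 mult_left_mono[OF m, of \<eta>] \<eta> by linarith
    also have "\<dots> = L * \<eta>" by (simp add: L_def algebra_simps)
    finally show ?thesis using \<eta> by simp
  qed
  ultimately show "\<exists>b\<in>coinc (at_conj k). rL (b - c) < \<epsilon>" by blast
qed

lemma closed_coinc_at_conj:
  fixes k :: "'a::real_normed_vector \<times> 'a dual \<Rightarrow> ereal"
  assumes "\<And>b. ereal (qL b) \<le> at_conj k b"
  shows "closed (coinc (at_conj k))"
proof -
  have "b \<in> coinc (at_conj k) \<longleftrightarrow> at_conj k b \<le> ereal (qL b)" for b
    using assms[of b] by (auto simp: coinc_def)
  moreover have "at_conj k b \<le> ereal (qL b) \<longleftrightarrow>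
      (\<forall>p\<in>strict_epi k. qL_pair (fst p) b - snd p \<le> qL b)" for b
    by (simp add: at_conj_le_iff Ball_def del: mem_strict_epi)
  ultimately have "coinc (at_conj k) = (\<Inter>p\<in>strict_epi k. {b. qL_pair (fst p) b - snd p \<le> qL b})"
    by auto
  moreover have "closed {b. qL_pair a b - s \<le> qL b}" for a :: "'a \<times> 'a dual" and s
    unfolding qL_pair_def qL_def by (intro closed_Collect_le continuous_intros)
  ultimately show ?thesis by auto
qed


section \<open>The sum theorem\<close>

theorem theorem5p4:
  fixes f g :: "'a::banach \<times> 'a dual \<Rightarrow> ereal"
  assumes "\<exists>x::'a. x \<noteq> 0"
    and "proper f" "econvex f" "lsc f"
    and "proper g" "econvex g" "lsc g"
    and "\<forall>b. ereal (qL b) \<le> f b" "\<forall>b. ereal (qL b) \<le> g b"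
    and "subspace (\<Union>l\<in>{0<..}. {l *\<^sub>R (s - t) |s t. s \<in> snd ` eff_dom f \<and> t \<in> snd ` eff_dom g})"
    and "closed (\<Union>l\<in>{0<..}. {l *\<^sub>R (s - t) |s t. s \<in> snd ` eff_dom f \<and> t \<in> snd ` eff_dom g})"
    and "quasidense (coinc f)" "quasidense (coinc g)"
  shows "(\<forall>b. ereal (qL b) \<le> at_conj (episum1 f g) b) \<and>
    closed (coinc (at_conj (episum1 f g))) \<and>
    quasidense (coinc (at_conj (episum1 f g))) \<and>
    (\<forall>y y'. (y, y') \<in> coinc (at_conj (episum1 f g)) \<longleftrightarrow>
      (\<exists>u'' v''. (y', u'') \<in> dcoinc (conjugate f) \<and>
        (y', v'') \<in> dcoinc (conjugate g) \<and> u'' + v'' = canon y))"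
proof -
  let ?h = "episum1 f g"
  let ?F = "\<Union>l\<in>{0<..}. {l *\<^sub>R (s - t) |s t. s \<in> snd ` eff_dom f \<and> t \<in> snd ` eff_dom g}"
  have fm: "f b \<noteq> -\<infinity>" and gm: "g b \<noteq> -\<infinity>" for b
    using assms(2,5) unfolding proper_def by blast+
  note cf = convex_strict_epi[OF assms(3)] and cg = convex_strict_epi[OF assms(6)]
  note epi = strict_epi_episum1[of f g, OF fm gm]
  have f': "ereal (blinfun_apply y'' y') \<le> conjugate f (y', y'')"
    and g': "ereal (blinfun_apply y'' y') \<le> conjugate g (y', y'')" for y' y''
    by (intro conjugate_ge_of_quasidense_coinc assms)+
  have split: "\<exists>u'' v'' A B. u'' + v'' = y'' \<and> A + B \<le> M \<and>
      conjugate f (y', u'') \<le> ereal A \<and> conjugate g (y', v'') \<le> ereal B"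
    if "conjugate ?h (y', y'') \<le> ereal M" for y' y'' M
    using conjugate_episum1_split[OF fm assms(3,4) gm assms(6,7,10,11) that] by metis
  have h': "ereal (blinfun_apply y'' y') \<le> conjugate ?h (y', y'')" for y' y''
  proof (rule ereal_le_if_real_bounds)
    fix M assume "conjugate ?h (y', y'') \<le> ereal M"
    then obtain u'' v'' A B where uv: "u'' + v'' = y''" "A + B \<le> M"
      "conjugate f (y', u'') \<le> ereal A" "conjugate g (y', v'') \<le> ereal B" using split by blast
    have "blinfun_apply u'' y' \<le> A" "blinfun_apply v'' y' \<le> B"
      using order_trans[OF f' uv(3)] order_trans[OF g' uv(4)] by auto
    then show "blinfun_apply y'' y' \<le> M" using uv(1,2) by (auto simp: blinfun.add_left)
  qed
  have h: "ereal (qL b) \<le> ?h b" for b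
  proof (rule ereal_le_if_real_bounds)
    obtain x x' where b: "b = (x, x')" by (cases b)
    fix M assume M: "?h b \<le> ereal M"
    have "qL b \<le> M + e" if "0 < e" for e
    proof -
      have "((x, x'), M + e) \<in> strict_epi ?h"
        using M that b by (auto intro: le_less_trans)
      then obtain x1 x2 r1 r2 where *: "x = x1 + x2" "M + e = r1 + r2"
        "((x1, x'), r1) \<in> strict_epi f" "((x2, x'), r2) \<in> strict_epi g" unfolding epi by blast
      have "qL (x1, x') \<le> r1" "qL (x2, x') \<le> r2"
        using strict_epi_ge_qL[OF cf _ *(3)] strict_epi_ge_qL[OF cg _ *(4)] assms(8,9) by auto
      then show ?thesis using * by (simp add: b qL_def blinfun.add_right)
    qed
    then show "qL b \<le> M" by (rule field_le_epsilon)
  qed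
  have ne: "strict_epi ?h \<noteq> {}"
  proof -
    have "0 \<in> ?F" using assms(10) by (rule subspace_0)
    then obtain p q where pq: "p \<in> eff_dom f" "q \<in> eff_dom g" "snd p = snd q" by auto
    obtain x1 s where p: "p = (x1, s)" by (cases p)
    obtain x2 where q: "q = (x2, s)" using pq p by (cases q) auto
    obtain a b where "f p = ereal a" "g q = ereal b" using pq by (auto simp: eff_dom_def)
    then have "((x1, s), a + 1) \<in> strict_epi f" "((x2, s), b + 1) \<in> strict_epi g"
      by (auto simp: p q)
    then have "((x1 + x2, s), (a + 1) + (b + 1)) \<in> strict_epi ?h" unfolding epi by blast
    then show ?thesis by blast
  qed
  have at: "ereal (qL b) \<le> at_conj ?h b" for b
    using h'[of "canon (fst b)" "snd b"] by (simp add: at_conj_def case_prod_beta' qL_def)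
  have "(y, y') \<in> coinc (at_conj ?h) \<longleftrightarrow>
      (\<exists>u'' v''. (y', u'') \<in> dcoinc (conjugate f) \<and> (y', v'') \<in> dcoinc (conjugate g) \<and> u'' + v'' = canon y)"
    (is "?L \<longleftrightarrow> ?R") for y y'
  proof
    assume ?L
    then have "conjugate ?h (y', canon y) \<le> ereal (blinfun_apply y' y)"
      by (simp add: coinc_def at_conj_def qL_def)
    then obtain u'' v'' A B where uv: "u'' + v'' = canon y" "A + B \<le> blinfun_apply y' y"
      "conjugate f (y', u'') \<le> ereal A" "conjugate g (y', v'') \<le> ereal B" using split by blast
    have "blinfun_apply u'' y' \<le> A" "blinfun_apply v'' y' \<le> B"
      using order_trans[OF f' uv(3)] order_trans[OF g' uv(4)] by auto
    moreover have "blinfun_apply u'' y' + blinfun_apply v'' y' = blinfun_apply y' y"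
      using uv(1) by (metis canon_apply blinfun.add_left)
    \<comment> \<open>Here \<open>A + B\<close> is squeezed between two equal numbers, which forces equality in both bounds.\<close>
    ultimately have "A = blinfun_apply u'' y'" "B = blinfun_apply v'' y'" using uv(2) by auto
    then have "(y', u'') \<in> dcoinc (conjugate f)" "(y', v'') \<in> dcoinc (conjugate g)"
      using uv(3,4) f'[of u'' y'] g'[of v'' y'] by (auto simp: dcoinc_def)
    then show ?R using uv(1) by blast
  next
    assume ?R
    then obtain u'' v'' where uv: "u'' + v'' = canon y"
      "conjugate f (y', u'') \<le> ereal (blinfun_apply u'' y')"
        "conjugate g (y', v'') \<le> ereal (blinfun_apply v'' y')"
      by (auto simp: dcoinc_def)
    have "blinfun_apply u'' y' + blinfun_apply v'' y' = blinfun_apply y' y"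
      using uv(1) by (metis canon_apply blinfun.add_left)
    then have "conjugate ?h (y', canon y) \<le> ereal (blinfun_apply y' y)"
      using conjugate_episum1_le[of f g, OF fm gm uv(2,3)] uv(1) by simp
    then show ?L using at[of "(y, y')"] by (simp add: coinc_def at_conj_def qL_def)
  qed
  moreover have "quasidense (coinc (at_conj ?h))"
    by (intro quasidense_coinc_at_conj convex_strict_epi_episum1 fm gm cf cg ne h h')
  ultimately show ?thesis using at closed_coinc_at_conj[of ?h, OF at] by blast
qed


end
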